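(* There is a constant $c$ such that for every $L\ge 2$ there is a unitary $U=U^{(4)}U^{(3)}U^{(2)}U^{(1)}$ on the $3L^2$ qubits of the subsystem toric code on the $L\times L$ periodic square lattice, where each $U^{(j)}$ is a translation-invariant product of $L^2$ pairwise disjoint CNOT gates, each acting on two qubits at lattice distance at most $c$, with the following properties. For every plaquette $p$, $U\overline X_pU^\dagger=J^X_p$ and $U\overline Z_pU^\dagger=J^Z_p$, where $J^X_p,J^Z_p$ are the single-qubit Pauli operators $X$ and $Z$ acting on the qubit at the bottom horizontal edge of $p$. The operators $A_p=US^X_pU^\dagger$ and $B_p=US^Z_pU^\dagger$ act only on the other $2L^2$ qubits (vertices and vertical edges), and these qubits can be identified with the edges of a (tilted) periodic square lattice so that $\{A_p\}_p$ and $\{B_p\}_p$ are exactly the star operators and the plaquette operators, respectively, of Kitaev's toric code on that lattice. Consequently, for $H=-\sum_T G(T)$, $$UHU^\dagger=-\sum_p\big(J^X_p+J^X_pA_p+J^Z_p+J^Z_pB_p\big),$$ and the ground states of $UHU^\dagger$ are exactly the states $\psi_{top}\otimes\psi_{anc}$, where $\psi_{top}$ is a ground state of Kitaev's toric code (i.e. $A_p\psi_{top}=B_p\psi_{top}=\psi_{top}$ for all $p$) and $\psi_{anc}$ is the tensor product, over all horizontal-edge qubits, of the single-qubit state with eigenvalue $\sqrt2$ of $X+Z$.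
   Context: Lattice: the square lattice of size $L\times L$ with periodic boundary conditions. One qubit sits at every vertex and one at the centre of every edge ($3L^2$ qubits in total). Triangles: a triangle is a triple $T=(u,f,g)$ where $u$ is a vertex and $f,g$ are two orthogonal edges incident to $u$; it belongs to the plaquette having both $f$ and $g$ on its boundary. $T$ is called SW, SE, NW or NE if $u$ is the south-west, south-east, north-west or north-east corner of that plaquette. Write $T^{SW}_p$, etc., for the triangles of plaquette $p$. Triangle operators: $G(T)=X_uX_fX_g$ if $T$ is SW or NE, and $G(T)=Z_uZ_fZ_g$ if $T$ is SE or NW, with $X_j,Z_j$ the Pauli operators on qubit $j$. For each plaquette $p$: $S^X_p=G(T^{SW}_p)G(T^{NE}_p)$, $S^Z_p=G(T^{SE}_p)G(T^{NW}_p)$ (stabilizers), and $\overline X_p=G(T^{SW}_p)$, $\overline Z_p=G(T^{SE}_p)$ (gauge-qubit logical operators). The sum defining $H$ runs over all triangles of the lattice. Kitaev's toric code on a periodic square lattice with qubits on edges has star operators $\prod_{e\ni v}X_e$ (one per vertex $v$) and plaquette operators $\prod_{e\in\partial f}Z_e$ (one per face $f$); its Hamiltonian is minus the sum of all these operators. *)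

theory Defs
  imports "Jordan_Normal_Form.Char_Poly" "Jordan_Normal_Form.Schur_Decomposition"
begin

section \<open>Qubit systems\<close>

text \<open>The Hilbert space of \<open>n\<close> qubits numbered \<open>0, \<dots>, n - 1\<close> has dimension \<open>2 ^ n\<close>; the
  computational basis state with index \<open>k < 2 ^ n\<close> has qubit \<open>q\<close> in the state \<open>bit k q\<close>.\<close>

definition sigma_x :: "complex mat" where
  "sigma_x = mat_of_rows_list 2 [[0, 1], [1, 0]]"

definition sigma_z :: "complex mat" where
  "sigma_z = mat_of_rows_list 2 [[1, 0], [0, - 1]]"

definition on_qubit :: "nat \<Rightarrow> nat \<Rightarrow> complex mat \<Rightarrow> complex mat" where
  "on_qubit n q M = mat (2 ^ n) (2 ^ n) (\<lambda>(r, c).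
     if \<forall>j<n. j \<noteq> q \<longrightarrow> bit r j = bit c j
     then M $$ (of_bool (bit r q), of_bool (bit c q)) else 0)"

definition cnot :: "nat \<Rightarrow> nat \<Rightarrow> nat \<Rightarrow> complex mat" where
  "cnot n a b = mat (2 ^ n) (2 ^ n) (\<lambda>(r, c).
     of_bool (r = (if bit c a then flip_bit b c else c)))"

definition mat_sum :: "nat \<Rightarrow> ('a \<Rightarrow> complex mat) \<Rightarrow> 'a set \<Rightarrow> complex mat" where
  "mat_sum N f A = mat N N (\<lambda>ij. \<Sum>a\<in>A. f a $$ ij)"

definition unitary_mat :: "nat \<Rightarrow> complex mat \<Rightarrow> bool" where
  "unitary_mat N U \<longleftrightarrow> U \<in> carrier_mat N N \<and>
     U * mat_adjoint U = 1\<^sub>m N \<and> mat_adjoint U * U = 1\<^sub>m N"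

definition conj_by :: "complex mat \<Rightarrow> complex mat \<Rightarrow> complex mat" where
  "conj_by U M = U * M * mat_adjoint U"

definition state :: "nat \<Rightarrow> complex vec \<Rightarrow> bool" where
  "state N \<psi> \<longleftrightarrow> \<psi> \<in> carrier_vec N \<and> \<psi> \<bullet>c \<psi> = 1"

text \<open>For Hermitian \<open>H\<close> all eigenvalues are real, so \<open>Re\<close> loses nothing.\<close>

definition ground_state :: "complex mat \<Rightarrow> complex vec \<Rightarrow> bool" where
  "ground_state H \<psi> \<longleftrightarrow> state (dim_row H) \<psi> \<and>
     (\<exists>E :: real. H *\<^sub>v \<psi> = complex_of_real E \<cdot>\<^sub>v \<psi> \<and> (\<forall>\<mu>. eigenvalue H \<mu> \<longrightarrow> E \<le> Re \<mu>))"

text \<open>Splitting \<open>m + k\<close> qubits into the first \<open>m\<close> and the last \<open>k\<close> ones: the tensor product of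
  two vectors, the operator \<open>A \<otimes> 1\<close>, and the product vector with the same factor on each of
  \<open>k\<close> qubits.\<close>

definition tensor_state :: "nat \<Rightarrow> nat \<Rightarrow> complex vec \<Rightarrow> complex vec \<Rightarrow> complex vec" where
  "tensor_state m k \<psi> \<phi> = vec (2 ^ (m + k)) (\<lambda>i. \<psi> $ take_bit m i * \<phi> $ drop_bit m i)"

definition tensor_id :: "nat \<Rightarrow> nat \<Rightarrow> complex mat \<Rightarrow> complex mat" where
  "tensor_id m k A = mat (2 ^ (m + k)) (2 ^ (m + k)) (\<lambda>(r, c).
     if drop_bit m r = drop_bit m c then A $$ (take_bit m r, take_bit m c) else 0)"

definition product_state :: "nat \<Rightarrow> complex vec \<Rightarrow> complex vec" where
  "product_state k \<chi> = vec (2 ^ k) (\<lambda>i. \<Prod>j<k. \<chi> $ of_bool (bit i j))"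

section \<open>The periodic square lattice\<close>

type_synonym site = "int \<times> int"

definition sites :: "nat \<Rightarrow> site set" where
  "sites L = {0..<int L} \<times> {0..<int L}"

definition shift :: "nat \<Rightarrow> site \<Rightarrow> site \<Rightarrow> site" where
  "shift L d s = ((fst s + fst d) mod int L, (snd s + snd d) mod int L)"

text \<open>\<open>HEdge s\<close> joins \<open>s\<close> to its eastern, \<open>VEdge s\<close> joins \<open>s\<close> to its northern neighbour.
  A plaquette is named after its south-west corner, so its bottom edge is \<open>HEdge p\<close>.\<close>

datatype qubit = Vertex site | HEdge site | VEdge site

definition qubits :: "nat \<Rightarrow> qubit set" where
  "qubits L = Vertex ` sites L \<union> HEdge ` sites L \<union> VEdge ` sites L"

text \<open>Vertices and vertical edges are numbered first, horizontal edges last.\<close>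

definition site_index :: "nat \<Rightarrow> site \<Rightarrow> nat" where
  "site_index L s = nat (fst s) * L + nat (snd s)"

fun idx :: "nat \<Rightarrow> qubit \<Rightarrow> nat" where
  "idx L (Vertex s) = site_index L s"
| "idx L (VEdge s) = L\<^sup>2 + site_index L s"
| "idx L (HEdge s) = 2 * L\<^sup>2 + site_index L s"

fun translate :: "nat \<Rightarrow> site \<Rightarrow> qubit \<Rightarrow> qubit" where
  "translate L d (Vertex s) = Vertex (shift L d s)"
| "translate L d (HEdge s) = HEdge (shift L d s)"
| "translate L d (VEdge s) = VEdge (shift L d s)"

text \<open>Positions in units of half a lattice spacing, so that edge centres are integral, and the
  Manhattan distance on the torus.\<close>

fun position2 :: "qubit \<Rightarrow> int \<times> int" where
  "position2 (Vertex (x, y)) = (2 * x, 2 * y)"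
| "position2 (HEdge (x, y)) = (2 * x + 1, 2 * y)"
| "position2 (VEdge (x, y)) = (2 * x, 2 * y + 1)"

definition cyclic_abs :: "int \<Rightarrow> int \<Rightarrow> int" where
  "cyclic_abs m a = min (a mod m) ((- a) mod m)"

definition lattice_dist :: "nat \<Rightarrow> qubit \<Rightarrow> qubit \<Rightarrow> real" where
  "lattice_dist L q r = real_of_int
     (cyclic_abs (2 * int L) (fst (position2 q) - fst (position2 r)) +
      cyclic_abs (2 * int L) (snd (position2 q) - snd (position2 r))) / 2"

definition pauli_X :: "nat \<Rightarrow> qubit \<Rightarrow> complex mat" where
  "pauli_X L q = on_qubit (3 * L\<^sup>2) (idx L q) sigma_x"

definition pauli_Z :: "nat \<Rightarrow> qubit \<Rightarrow> complex mat" where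
  "pauli_Z L q = on_qubit (3 * L\<^sup>2) (idx L q) sigma_z"

section \<open>The subsystem toric code\<close>

type_synonym triangle = "qubit \<times> qubit \<times> qubit"

text \<open>A triangle \<open>(u, f, g)\<close> lists its vertex, its horizontal edge and its vertical edge, so each
  triangle is counted once.\<close>

definition triangles :: "nat \<Rightarrow> triangle set" where
  "triangles L = {(Vertex u, HEdge s, VEdge t) | u s t.
     u \<in> sites L \<and> s \<in> sites L \<and> t \<in> sites L \<and>
     (u = s \<or> u = shift L (1, 0) s) \<and> (u = t \<or> u = shift L (0, 1) t)}"

definition T_SW :: "nat \<Rightarrow> site \<Rightarrow> triangle" where
  "T_SW L p = (Vertex p, HEdge p, VEdge p)"

definition T_SE :: "nat \<Rightarrow> site \<Rightarrow> triangle" where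
  "T_SE L p = (Vertex (shift L (1, 0) p), HEdge p, VEdge (shift L (1, 0) p))"

definition T_NW :: "nat \<Rightarrow> site \<Rightarrow> triangle" where
  "T_NW L p = (Vertex (shift L (0, 1) p), HEdge (shift L (0, 1) p), VEdge p)"

definition T_NE :: "nat \<Rightarrow> site \<Rightarrow> triangle" where
  "T_NE L p = (Vertex (shift L (1, 1) p), HEdge (shift L (0, 1) p), VEdge (shift L (1, 0) p))"

definition G :: "nat \<Rightarrow> triangle \<Rightarrow> complex mat" where
  "G L T = (case T of (u, f, g) \<Rightarrow>
     if T \<in> T_SW L ` sites L \<union> T_NE L ` sites L
     then pauli_X L u * pauli_X L f * pauli_X L g
     else pauli_Z L u * pauli_Z L f * pauli_Z L g)"

definition S_X :: "nat \<Rightarrow> site \<Rightarrow> complex mat" where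
  "S_X L p = G L (T_SW L p) * G L (T_NE L p)"

definition S_Z :: "nat \<Rightarrow> site \<Rightarrow> complex mat" where
  "S_Z L p = G L (T_SE L p) * G L (T_NW L p)"

definition X_bar :: "nat \<Rightarrow> site \<Rightarrow> complex mat" where
  "X_bar L p = G L (T_SW L p)"

definition Z_bar :: "nat \<Rightarrow> site \<Rightarrow> complex mat" where
  "Z_bar L p = G L (T_SE L p)"

definition J_X :: "nat \<Rightarrow> site \<Rightarrow> complex mat" where
  "J_X L p = pauli_X L (HEdge p)"

definition J_Z :: "nat \<Rightarrow> site \<Rightarrow> complex mat" where
  "J_Z L p = pauli_Z L (HEdge p)"

definition hamiltonian :: "nat \<Rightarrow> complex mat" where
  "hamiltonian L = - mat_sum (2 ^ (3 * L\<^sup>2)) (G L) (triangles L)"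

section \<open>Rounds of CNOT gates\<close>

text \<open>A gate is a pair (control, target). The gates of a round are disjoint and hence commute, so
  the order of the list is irrelevant.\<close>

definition cnot_round :: "nat \<Rightarrow> real \<Rightarrow> (qubit \<times> qubit) list \<Rightarrow> bool" where
  "cnot_round L c gs \<longleftrightarrow>
     distinct gs \<and> length gs = L\<^sup>2 \<and>
     (\<forall>(a, b) \<in> set gs. a \<in> qubits L \<and> b \<in> qubits L \<and> a \<noteq> b \<and> lattice_dist L a b \<le> c) \<and>
     pairwise (\<lambda>(a, b) (a', b'). {a, b} \<inter> {a', b'} = {}) (set gs) \<and>
     (\<forall>d. (\<lambda>(a, b). (translate L d a, translate L d b)) ` set gs = set gs)"

definition cnot_product :: "nat \<Rightarrow> (qubit \<times> qubit) list \<Rightarrow> complex mat" where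
  "cnot_product L gs =
     foldr (\<lambda>(a, b) M. cnot (3 * L\<^sup>2) (idx L a) (idx L b) * M) gs (1\<^sub>m (2 ^ (3 * L\<^sup>2)))"

section \<open>Kitaev's toric code on a tilted lattice\<close>

text \<open>The tilted lattice has the same sites, and lattice vectors \<open>e1\<close>, \<open>e2\<close> forming a basis of
  the integer lattice; \<open>Edge1 s\<close> joins \<open>s\<close> to \<open>s + e1\<close> and \<open>Edge2 s\<close> joins \<open>s\<close> to \<open>s + e2\<close>.
  The untilted lattice is the case \<open>e1 = (1, 0)\<close>, \<open>e2 = (0, 1)\<close>. The face named \<open>s\<close> has the
  corners \<open>s\<close>, \<open>s + e1\<close>, \<open>s + e2\<close> and \<open>s + e1 + e2\<close>.\<close>

definition lattice_basis :: "site \<Rightarrow> site \<Rightarrow> bool" where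
  "lattice_basis e1 e2 \<longleftrightarrow> \<bar>fst e1 * snd e2 - snd e1 * fst e2\<bar> = 1"

datatype toric_edge = Edge1 site | Edge2 site

definition toric_edges :: "nat \<Rightarrow> toric_edge set" where
  "toric_edges L = Edge1 ` sites L \<union> Edge2 ` sites L"

text \<open>The qubits left after removing the horizontal edges: exactly those with index below
  \<open>2 * L\<^sup>2\<close>.\<close>

definition top_qubits :: "nat \<Rightarrow> qubit set" where
  "top_qubits L = Vertex ` sites L \<union> VEdge ` sites L"

text \<open>In the following, \<open>\<iota>\<close> identifies the edges of the tilted lattice with the qubits in
  \<open>top_qubits L\<close>; the operators act on these qubits alone.\<close>

definition toric_X :: "nat \<Rightarrow> (toric_edge \<Rightarrow> qubit) \<Rightarrow> toric_edge \<Rightarrow> complex mat" where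
  "toric_X L \<iota> e = on_qubit (2 * L\<^sup>2) (idx L (\<iota> e)) sigma_x"

definition toric_Z :: "nat \<Rightarrow> (toric_edge \<Rightarrow> qubit) \<Rightarrow> toric_edge \<Rightarrow> complex mat" where
  "toric_Z L \<iota> e = on_qubit (2 * L\<^sup>2) (idx L (\<iota> e)) sigma_z"

definition star_op ::
  "nat \<Rightarrow> site \<Rightarrow> site \<Rightarrow> (toric_edge \<Rightarrow> qubit) \<Rightarrow> site \<Rightarrow> complex mat" where
  "star_op L e1 e2 \<iota> v =
     toric_X L \<iota> (Edge1 v) * toric_X L \<iota> (Edge1 (shift L (- fst e1, - snd e1) v)) *
     toric_X L \<iota> (Edge2 v) * toric_X L \<iota> (Edge2 (shift L (- fst e2, - snd e2) v))"

definition face_op ::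
  "nat \<Rightarrow> site \<Rightarrow> site \<Rightarrow> (toric_edge \<Rightarrow> qubit) \<Rightarrow> site \<Rightarrow> complex mat" where
  "face_op L e1 e2 \<iota> f =
     toric_Z L \<iota> (Edge1 f) * toric_Z L \<iota> (Edge1 (shift L e2 f)) *
     toric_Z L \<iota> (Edge2 f) * toric_Z L \<iota> (Edge2 (shift L e1 f))"

definition toric_hamiltonian ::
  "nat \<Rightarrow> site \<Rightarrow> site \<Rightarrow> (toric_edge \<Rightarrow> qubit) \<Rightarrow> complex mat" where
  "toric_hamiltonian L e1 e2 \<iota> =
     - (mat_sum (2 ^ (2 * L\<^sup>2)) (star_op L e1 e2 \<iota>) (sites L) +
        mat_sum (2 ^ (2 * L\<^sup>2)) (face_op L e1 e2 \<iota>) (sites L))"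

end

(*
  In the first two rounds every horizontal edge is the control of the CNOTs onto its west vertex and
  onto the vertical edge above that vertex; in the last two rounds every vertex and every vertical
  edge is the control of a CNOT onto the horizontal edge to its west. On a Pauli string, written as
  the indicator function of its support, a round acts by adding values along its gates: X spreads
  from control to target and Z from target to control. Four such additions turn the triangle
  operators of a plaquette p into the single-qubit operators at its bottom edge, and the
  stabilizers into four-body operators which are the stars and faces of the lattice spanned by
  (1, 0) and (1, -1).

  Both ground state characterizations come from the frustration-free criterion: if every local term
  K has expectation at most c in every state, with equality only for certain states, and some state
  attains equality in all terms, then the ground states are exactly the common maximizers. For
  K = J (1 + A) + J' (1 + B), where J and J' anticommute, K^2 = 4 + 2 A + 2 B <= 8 gives
  c = 2 sqrt 2, attained exactly when A = B = 1 and J + J' = sqrt 2. For the toric code the uniform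
  superposition of all bit strings of even parity around every face attains equality.
*)
theory Submission
  imports Defs
begin

unbundle bit_operations_syntax

section \<open>Pauli strings and CNOT gates as monomial matrices\<close>

text \<open>The circuit can be read off from the two triangles that define the gauge operators. All
  three qubits of the X triangle at the south-west corner belong to one site, so copying the
  horizontal edge onto the vertex and the vertical edge there erases both. The Z triangle at the
  south-east corner has its vertex and vertical edge at the next site to the east; the last two
  rounds copy the bottom edge onto exactly these two and erase them. The halves do not disturb each
  other: the vertex and the vertical edge of a site act as a pair whose equal contributions cancel
  modulo 2. To carry this out with explicit matrices, Pauli strings and CNOT gates are written as
  monomial matrices, which turns operator identities into identities between maps on basis indices.
  Ground states are defined through eigenvalues, whereas the local estimates concern expectations.
  The bridge is that the expectation of the Hamiltonian in a normalised eigenvector is the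
  eigenvalue.\<close>

lemma nat_less_exp_iff_bit: "c < 2 ^ n \<longleftrightarrow> (\<forall>j\<ge>n. \<not> bit c j)" for c :: nat
proof -
  have "c < 2 ^ n \<longleftrightarrow> take_bit n c = c"
    by (rule take_bit_nat_eq_self_iff [symmetric])
  also have "\<dots> \<longleftrightarrow> (\<forall>j\<ge>n. \<not> bit c j)"
    unfolding bit_eq_iff bit_take_bit_iff by (metis not_le possible_bit_nat)
  finally show ?thesis .
qed

lemma nat_eq_iff_bits_below:
  fixes r c :: nat
  assumes "r < 2 ^ n" "c < 2 ^ n"
  shows "r = c \<longleftrightarrow> (\<forall>j<n. bit r j = bit c j)"
  using assms unfolding nat_less_exp_iff_bit by (metis bit_eqI not_le)

text \<open>Column \<open>c\<close> carries its only possible entry \<open>g c\<close> in row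
  \<open>f c\<close>. Pauli strings and CNOT gates all have this shape, and their products reduce to
  composition of the index maps.\<close>

definition mono_mat :: "nat \<Rightarrow> (nat \<Rightarrow> nat) \<Rightarrow> (nat \<Rightarrow> complex) \<Rightarrow> complex mat" where
  "mono_mat N f g = mat N N (\<lambda>(r, c). if r = f c then g c else 0)"

lemma mono_mat_carrier [simp]: "mono_mat N f g \<in> carrier_mat N N"
  by (simp add: mono_mat_def)

lemma mono_mat_cong:
  assumes "\<And>c. c < N \<Longrightarrow> f c = f' c" "\<And>c. c < N \<Longrightarrow> g c = g' c"
  shows "mono_mat N f g = mono_mat N f' g'"
  by (rule eq_matI) (auto simp: mono_mat_def assms)

lemma mono_mat_mult:
  assumes "\<And>c. c < N \<Longrightarrow> f' c < N"
  shows "mono_mat N f g * mono_mat N f' g' = mono_mat N (f \<circ> f') (\<lambda>c. g (f' c) * g' c)"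
proof (rule eq_matI)
  fix i j assume "i < dim_row (mono_mat N (f \<circ> f') (\<lambda>c. g (f' c) * g' c))"
    "j < dim_col (mono_mat N (f \<circ> f') (\<lambda>c. g (f' c) * g' c))"
  then have ij: "i < N" "j < N" by (auto simp: mono_mat_def)
  have "(mono_mat N f g * mono_mat N f' g') $$ (i, j) =
      (\<Sum>k<N. (if i = f k then g k else 0) * (if k = f' j then g' j else 0))"
    using ij by (simp add: mono_mat_def scalar_prod_def atLeast0LessThan)
  also have "\<dots> = (\<Sum>k<N. if k = f' j then (if i = f k then g k else 0) * g' j else 0)"
    by (rule sum.cong) auto
  also have "\<dots> = (if i = f (f' j) then g (f' j) * g' j else 0)"
    using assms[OF ij(2)] by simp
  finally show "(mono_mat N f g * mono_mat N f' g') $$ (i, j) =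
      mono_mat N (f \<circ> f') (\<lambda>c. g (f' c) * g' c) $$ (i, j)"
    using ij by (simp add: mono_mat_def)
qed (auto simp: mono_mat_def)

text \<open>Since \<open>f\<close> is an involution, the only column that feeds row \<open>r\<close>
  is \<open>f r\<close>.\<close>

lemma mono_mat_mult_vec:
  assumes "\<And>c. c < N \<Longrightarrow> f c < N" "\<And>c. c < N \<Longrightarrow> f (f c) = c" "v \<in> carrier_vec N" "r < N"
  shows "(mono_mat N f g *\<^sub>v v) $ r = g (f r) * v $ f r"
proof -
  have "(mono_mat N f g *\<^sub>v v) $ r = (\<Sum>c<N. (if r = f c then g c else 0) * v $ c)"
    using assms(3,4) by (auto simp: mono_mat_def scalar_prod_def atLeast0LessThan)
  also have "\<dots> = (\<Sum>c<N. if c = f r then g (f r) * v $ f r else 0)"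
    by (rule sum.cong) (auto simp: assms)
  also have "\<dots> = g (f r) * v $ f r"
    using assms(1,4) by simp
  finally show ?thesis .
qed

lemma one_mat_eq_mono_mat: "1\<^sub>m N = mono_mat N id (\<lambda>_. 1)"
  by (rule eq_matI) (auto simp: mono_mat_def)

lemma mat_adjoint_eq: "mat_adjoint A = mat (dim_col A) (dim_row A) (\<lambda>(i, j). cnj (A $$ (j, i)))"
  by (rule eq_matI) (auto simp: mat_adjoint_def mat_of_rows_def)

lemma mat_adjoint_carrier [simp]: "A \<in> carrier_mat n m \<Longrightarrow> mat_adjoint A \<in> carrier_mat m n"
  for A :: "complex mat"
  by (rule carrier_matI) (simp_all add: mat_adjoint_eq)

lemma mat_adjoint_mult:
  assumes "A \<in> carrier_mat n m" "B \<in> carrier_mat m k"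
  shows "mat_adjoint (A * B :: complex mat) = mat_adjoint B * mat_adjoint A"
  by (rule eq_matI)
    (use assms in \<open>auto simp: mat_adjoint_eq scalar_prod_def mult.commute intro!: sum.cong\<close>)

text \<open>Transposing replaces \<open>f\<close> by its inverse, which is \<open>f\<close> itself,
  and turns the entry \<open>g c\<close> into \<open>cnj (g (f c))\<close>; the hypothesis on
  \<open>g\<close> is therefore exactly Hermiticity.\<close>

lemma mat_adjoint_mono_mat:
  assumes "\<And>c. c < N \<Longrightarrow> f (f c) = c" "\<And>c. c < N \<Longrightarrow> f c < N" "\<And>c. c < N \<Longrightarrow> g (f c) = cnj (g c)"
  shows "mat_adjoint (mono_mat N f g) = mono_mat N f g"
proof (rule eq_matI)
  fix i j assume "i < dim_row (mono_mat N f g)" "j < dim_col (mono_mat N f g)"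
  then have ij: "i < N" "j < N" by (auto simp: mono_mat_def)
  then have "j = f i \<longleftrightarrow> i = f j" "i = f j \<Longrightarrow> g i = cnj (g j)"
    using assms by metis+
  then show "mat_adjoint (mono_mat N f g) $$ (i, j) = mono_mat N f g $$ (i, j)"
    using ij by (auto simp: mat_adjoint_eq mono_mat_def)
qed (auto simp: mat_adjoint_eq mono_mat_def)

section \<open>Bit masks and Pauli strings\<close>

definition bits_of :: "nat \<Rightarrow> (nat \<Rightarrow> bool) \<Rightarrow> nat" where
  "bits_of n s = horner_sum of_bool 2 (map s [0..<n])"

lemma bit_bits_of [simp]: "bit (bits_of n s) j \<longleftrightarrow> j < n \<and> s j"
  by (auto simp: bits_of_def bit_horner_sum_bit_iff)

lemma bits_of_less [simp]: "bits_of n s < 2 ^ n"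
  by (auto simp: nat_less_exp_iff_bit)

lemma xor_less_exp: "c < 2 ^ n \<Longrightarrow> m < 2 ^ n \<Longrightarrow> c XOR m < 2 ^ n" for c m :: nat
  by (auto simp: nat_less_exp_iff_bit bit_xor_iff)

definition xstr :: "nat \<Rightarrow> (nat \<Rightarrow> bool) \<Rightarrow> complex mat" where
  "xstr n s = mono_mat (2 ^ n) (\<lambda>c. c XOR bits_of n s) (\<lambda>_. 1)"

text \<open>At a basis index this is the diagonal entry of a product of Z operators. At a mask
  \<open>bits_of n t\<close> it is minus one to the size of the overlap of \<open>s\<close> and
  \<open>t\<close>, the sign picked up when the Z string on \<open>s\<close> moves past the X string
  on \<open>t\<close>.\<close>

definition zsign :: "nat \<Rightarrow> (nat \<Rightarrow> bool) \<Rightarrow> nat \<Rightarrow> complex" where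
  "zsign n s c = (\<Prod>j<n. if s j \<and> bit c j then - 1 else 1)"

definition zstr :: "nat \<Rightarrow> (nat \<Rightarrow> bool) \<Rightarrow> complex mat" where
  "zstr n s = mono_mat (2 ^ n) id (zsign n s)"

lemma xstr_carrier [simp]: "xstr n s \<in> carrier_mat (2 ^ n) (2 ^ n)"
  and zstr_carrier [simp]: "zstr n s \<in> carrier_mat (2 ^ n) (2 ^ n)"
  by (simp_all add: xstr_def zstr_def)

lemma zsign_mult: "zsign n s c * zsign n t c = zsign n (\<lambda>j. s j \<noteq> t j) c"
  unfolding zsign_def prod.distrib[symmetric] by (rule prod.cong) auto

text \<open>For fixed \<open>s\<close> the sign is a character of bit strings under XOR. This is how
  commutation signs enter the computations below.\<close>

lemma zsign_xor: "zsign n s (c XOR d) = zsign n s c * zsign n s d"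
  unfolding zsign_def prod.distrib[symmetric] by (rule prod.cong) (auto simp: bit_xor_iff)

lemma zsign_square [simp]: "zsign n s c * zsign n s c = 1"
  unfolding zsign_def prod.distrib[symmetric] by (rule prod.neutral) auto

lemma cnj_zsign [simp]: "cnj (zsign n s c) = zsign n s c"
  unfolding zsign_def cnj_prod by (rule prod.cong) auto

lemma norm_zsign [simp]: "cmod (zsign n s c) = 1"
  unfolding zsign_def by (simp add: prod_norm[symmetric] if_distrib[of cmod] prod.neutral)

lemma xstr_mult: "xstr n s * xstr n t = xstr n (\<lambda>j. s j \<noteq> t j)"
  unfolding xstr_def
  by (subst mono_mat_mult)
    (auto simp: xor_less_exp bit_xor_iff intro!: mono_mat_cong bit_eqI)

lemma zstr_mult: "zstr n s * zstr n t = zstr n (\<lambda>j. s j \<noteq> t j)"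
  unfolding zstr_def by (subst mono_mat_mult) (auto simp: zsign_mult intro!: mono_mat_cong)

lemma mat_adjoint_xstr [simp]: "mat_adjoint (xstr n s) = xstr n s"
  unfolding xstr_def by (rule mat_adjoint_mono_mat) (auto simp: xor_less_exp xor.assoc)

lemma mat_adjoint_zstr [simp]: "mat_adjoint (zstr n s) = zstr n s"
  unfolding zstr_def by (rule mat_adjoint_mono_mat) auto

lemma xstr_mult_vec:
  assumes "v \<in> carrier_vec (2 ^ n)" "r < 2 ^ n"
  shows "(xstr n s *\<^sub>v v) $ r = v $ (r XOR bits_of n s)"
  unfolding xstr_def
  by (subst mono_mat_mult_vec) (use assms in \<open>auto simp: xor_less_exp xor.assoc\<close>)

lemma zstr_mult_vec:
  assumes "v \<in> carrier_vec (2 ^ n)" "r < 2 ^ n"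
  shows "(zstr n s *\<^sub>v v) $ r = zsign n s r * v $ r"
  unfolding zstr_def by (subst mono_mat_mult_vec) (use assms in auto)

lemma sigma_x_index: "sigma_x $$ (of_bool a, of_bool b) = of_bool (a \<noteq> b)"
  by (auto simp: sigma_x_def mat_of_rows_list_def)

lemma sigma_z_index: "sigma_z $$ (of_bool a, of_bool b) = (if a = b then if a then - 1 else 1 else 0)"
  by (auto simp: sigma_z_def mat_of_rows_list_def)

lemma on_qubit_sigma_x:
  assumes "q < n"
  shows "on_qubit n q sigma_x = xstr n (\<lambda>j. j = q)"
proof (rule eq_matI)
  fix r c assume "r < dim_row (xstr n (\<lambda>j. j = q))" "c < dim_col (xstr n (\<lambda>j. j = q))"
  then have rc: "r < 2 ^ n" "c < 2 ^ n" by (auto simp: xstr_def mono_mat_def)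
  have "r = c XOR bits_of n (\<lambda>j. j = q) \<longleftrightarrow>
      (\<forall>j<n. j \<noteq> q \<longrightarrow> bit r j = bit c j) \<and> bit r q \<noteq> bit c q"
    using assms by (auto simp: nat_eq_iff_bits_below[OF rc(1) xor_less_exp[OF rc(2) bits_of_less]]
      bit_xor_iff)
  then show "on_qubit n q sigma_x $$ (r, c) = xstr n (\<lambda>j. j = q) $$ (r, c)"
    using rc by (auto simp: on_qubit_def xstr_def mono_mat_def sigma_x_index)
qed (auto simp: on_qubit_def xstr_def mono_mat_def)

lemma zsign_single: "q < n \<Longrightarrow> zsign n (\<lambda>j. j = q) c = (if bit c q then - 1 else 1)"
  unfolding zsign_def by (subst prod.remove[of _ q]) (auto intro!: prod.neutral)

lemma on_qubit_sigma_z: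
  assumes "q < n"
  shows "on_qubit n q sigma_z = zstr n (\<lambda>j. j = q)"
proof (rule eq_matI)
  fix r c assume "r < dim_row (zstr n (\<lambda>j. j = q))" "c < dim_col (zstr n (\<lambda>j. j = q))"
  then have rc: "r < 2 ^ n" "c < 2 ^ n" by (auto simp: zstr_def mono_mat_def)
  have "r = c \<longleftrightarrow> (\<forall>j<n. j \<noteq> q \<longrightarrow> bit r j = bit c j) \<and> bit r q = bit c q"
    using assms unfolding nat_eq_iff_bits_below[OF rc] by blast
  then show "on_qubit n q sigma_z $$ (r, c) = zstr n (\<lambda>j. j = q) $$ (r, c)"
    using rc assms by (auto simp: on_qubit_def zstr_def mono_mat_def sigma_z_index zsign_single)
qed (auto simp: on_qubit_def zstr_def mono_mat_def)

section \<open>CNOT gates and their action on Pauli strings\<close>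

definition cnot_flip :: "nat \<Rightarrow> nat \<Rightarrow> nat \<Rightarrow> nat" where
  "cnot_flip a b c = (if bit c a then flip_bit b c else c)"

lemma bit_cnot_flip: "bit (cnot_flip a b c) j \<longleftrightarrow> bit c j \<noteq> (j = b \<and> bit c a)"
  by (auto simp: cnot_flip_def bit_flip_bit_iff)

lemma cnot_eq_mono_mat: "cnot n a b = mono_mat (2 ^ n) (cnot_flip a b) (\<lambda>_. 1)"
  by (rule eq_matI) (auto simp: cnot_def mono_mat_def cnot_flip_def)

lemma cnot_carrier [simp]: "cnot n a b \<in> carrier_mat (2 ^ n) (2 ^ n)"
  by (simp add: cnot_eq_mono_mat)

lemma cnot_flip_less: "b < n \<Longrightarrow> c < 2 ^ n \<Longrightarrow> cnot_flip a b c < 2 ^ n"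
  by (auto simp: nat_less_exp_iff_bit bit_cnot_flip)

lemma cnot_flip_idem: "a \<noteq> b \<Longrightarrow> cnot_flip a b (cnot_flip a b c) = c"
  by (rule bit_eqI) (auto simp: bit_cnot_flip)

lemma mat_adjoint_cnot: "a \<noteq> b \<Longrightarrow> b < n \<Longrightarrow> mat_adjoint (cnot n a b) = cnot n a b"
  unfolding cnot_eq_mono_mat
  by (rule mat_adjoint_mono_mat) (auto simp: cnot_flip_less cnot_flip_idem)

lemma cnot_square: "a \<noteq> b \<Longrightarrow> b < n \<Longrightarrow> cnot n a b * cnot n a b = 1\<^sub>m (2 ^ n)"
  unfolding cnot_eq_mono_mat one_mat_eq_mono_mat
  by (subst mono_mat_mult) (auto simp: cnot_flip_less cnot_flip_idem intro!: mono_mat_cong)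

lemma unitary_cnot: "a \<noteq> b \<Longrightarrow> b < n \<Longrightarrow> unitary_mat (2 ^ n) (cnot n a b)"
  by (simp add: unitary_mat_def mat_adjoint_cnot cnot_square)

text \<open>\<open>cnot_flip a b\<close> is linear over the field with two elements, so it sends an
  XOR to the XOR of the images; on the mask of \<open>s\<close> it changes bit \<open>b\<close>
  exactly as the update of \<open>s\<close> does.\<close>

lemma cnot_xstr:
  assumes "a \<noteq> b" "a < n" "b < n"
  shows "cnot n a b * xstr n s = xstr n (s(b := (s b \<noteq> s a))) * cnot n a b"
proof -
  have "cnot_flip a b (c XOR bits_of n s) =
      cnot_flip a b c XOR bits_of n (s(b := (s b \<noteq> s a)))" for c
    by (rule bit_eqI) (use assms in \<open>auto simp: bit_cnot_flip bit_xor_iff\<close>)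
  then show ?thesis
    unfolding cnot_eq_mono_mat xstr_def
    by (subst (1 2) mono_mat_mult)
      (use assms in \<open>auto simp: xor_less_exp cnot_flip_less intro!: mono_mat_cong\<close>)
qed

lemma prod_remove_two:
  fixes g :: "nat \<Rightarrow> 'a :: comm_monoid_mult"
  assumes "a \<noteq> b" "a < n" "b < n"
  shows "prod g {..<n} = (g a * g b) * prod g ({..<n} - {a} - {b})"
  using assms by (subst prod.remove[of _ a], simp, simp, subst prod.remove[of _ b])
    (simp_all add: mult.assoc)

text \<open>This is the transposed linear map. In exponents of minus one,
  \<open>(s a + s b) * c a + s b * (c a + c b)\<close> equals \<open>s a * c a + s b * c b\<close>
  modulo 2. Only the factors at \<open>a\<close> and \<open>b\<close> are affected, hence the
  splitting of the product.\<close>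

lemma cnot_zstr:
  assumes "a \<noteq> b" "a < n" "b < n"
  shows "cnot n a b * zstr n s = zstr n (s(a := (s a \<noteq> s b))) * cnot n a b"
proof -
  have "zsign n (s(a := (s a \<noteq> s b))) (cnot_flip a b c) = zsign n s c" for c
    unfolding zsign_def prod_remove_two[OF assms]
    by (rule arg_cong2[of _ _ _ _ "(*)"])
      (use assms in \<open>auto simp: bit_cnot_flip intro!: prod.cong\<close>)
  then show ?thesis
    unfolding cnot_eq_mono_mat zstr_def
    by (subst (1 2) mono_mat_mult)
      (use assms in \<open>auto simp: cnot_flip_less intro!: mono_mat_cong\<close>)
qed

section \<open>Conjugation by unitaries\<close>

lemma unitary_mat_mult:
  assumes "unitary_mat N U" "unitary_mat N V"
  shows "unitary_mat N (U * V)"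
proof -
  from assms have c: "U \<in> carrier_mat N N" "V \<in> carrier_mat N N"
    and uU: "U * mat_adjoint U = 1\<^sub>m N" "mat_adjoint U * U = 1\<^sub>m N"
    and uV: "V * mat_adjoint V = 1\<^sub>m N" "mat_adjoint V * V = 1\<^sub>m N"
    by (auto simp: unitary_mat_def)
  note ca = mat_adjoint_carrier[OF c(1)] mat_adjoint_carrier[OF c(2)]
  have "U * V * (mat_adjoint V * mat_adjoint U) = U * (V * mat_adjoint V) * mat_adjoint U"
    using c ca
    by (simp add: assoc_mult_mat[of _ N N _ N _ N] mult_carrier_mat[of _ N N _ N])
  moreover have "mat_adjoint V * mat_adjoint U * (U * V) = mat_adjoint V * (mat_adjoint U * U) * V"
    using c ca
    by (simp add: assoc_mult_mat[of _ N N _ N _ N] mult_carrier_mat[of _ N N _ N])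
  ultimately show ?thesis
    using c ca uU uV by (simp add: unitary_mat_def mat_adjoint_mult[OF c])
qed

lemma unitary_one_mat: "unitary_mat N (1\<^sub>m N)"
proof -
  have "mat_adjoint (1\<^sub>m N :: complex mat) = 1\<^sub>m N"
    by (rule eq_matI) (auto simp: mat_adjoint_eq)
  then show ?thesis by (simp add: unitary_mat_def)
qed

lemma conj_by_carrier [simp]:
  "unitary_mat N U \<Longrightarrow> A \<in> carrier_mat N N \<Longrightarrow> conj_by U A \<in> carrier_mat N N"
  by (auto simp: conj_by_def unitary_mat_def intro!: mult_carrier_mat)

lemma conj_by_compose:
  assumes "unitary_mat N U" "unitary_mat N V" "A \<in> carrier_mat N N"
  shows "conj_by (U * V) A = conj_by U (conj_by V A)"
proof -
  from assms have c: "U \<in> carrier_mat N N" "V \<in> carrier_mat N N"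
    by (auto simp: unitary_mat_def)
  note ca = mat_adjoint_carrier[OF c(1)] mat_adjoint_carrier[OF c(2)]
  show ?thesis
    using c ca assms(3)
    by (simp add: conj_by_def mat_adjoint_mult[OF c] assoc_mult_mat[of _ N N _ N _ N]
      mult_carrier_mat[of _ N N _ N])
qed

text \<open>Trades the threefold product for \<open>U * A = B * U\<close>, the form in which the two
  CNOT rules are proved.\<close>

lemma conj_by_eqI:
  assumes "unitary_mat N U" "B \<in> carrier_mat N N" "U * A = B * U"
  shows "conj_by U A = B"
  using assms by (simp add: conj_by_def unitary_mat_def assoc_mult_mat[of _ N N _ N _ N])

lemma conj_by_mult:
  assumes "unitary_mat N U" "A \<in> carrier_mat N N" "B \<in> carrier_mat N N"
  shows "conj_by U (A * B) = conj_by U A * conj_by U B"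
proof -
  from assms have c: "U \<in> carrier_mat N N" and u: "mat_adjoint U * U = 1\<^sub>m N"
    by (auto simp: unitary_mat_def)
  note ca = mat_adjoint_carrier[OF c]
  have "conj_by U A * conj_by U B = U * A * (mat_adjoint U * U) * (B * mat_adjoint U)"
    unfolding conj_by_def using c ca assms(2,3)
    by (simp add: assoc_mult_mat[of _ N N _ N _ N] mult_carrier_mat[of _ N N _ N])
  also have "\<dots> = conj_by U (A * B)"
    unfolding conj_by_def u using c ca assms(2,3)
    by (simp add: assoc_mult_mat[of _ N N _ N _ N] mult_carrier_mat[of _ N N _ N])
  finally show ?thesis by simp
qed

section \<open>Finite sums of operators\<close>

lemma mat_sum_carrier [simp]: "mat_sum N f A \<in> carrier_mat N N"
  by (simp add: mat_sum_def)

lemma mat_sum_cong: "(\<And>a. a \<in> A \<Longrightarrow> f a = g a) \<Longrightarrow> mat_sum N f A = mat_sum N g A"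
  unfolding mat_sum_def by (rule eq_matI) auto

lemma mat_sum_empty: "mat_sum N f {} = 0\<^sub>m N N"
  unfolding mat_sum_def by (rule eq_matI) auto

lemma mat_sum_insert:
  assumes "finite A" "a \<notin> A" "f a \<in> carrier_mat N N"
  shows "mat_sum N f (insert a A) = f a + mat_sum N f A"
  unfolding mat_sum_def by (rule eq_matI) (use assms in auto)

lemma mat_sum_reindex:
  "inj_on h A \<Longrightarrow> mat_sum N f (h ` A) = mat_sum N (\<lambda>a. f (h a)) A"
  unfolding mat_sum_def by (rule eq_matI) (auto simp: sum.reindex)

lemma mat_sum_union_disjoint:
  "finite A \<Longrightarrow> finite B \<Longrightarrow> A \<inter> B = {} \<Longrightarrow> mat_sum N f (A \<union> B) = mat_sum N f A + mat_sum N f B"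
  unfolding mat_sum_def by (rule eq_matI) (auto simp: sum.union_disjoint)

lemma mat_sum_add:
  assumes "\<And>a. a \<in> A \<Longrightarrow> f a \<in> carrier_mat N N" "\<And>a. a \<in> A \<Longrightarrow> g a \<in> carrier_mat N N"
  shows "mat_sum N f A + mat_sum N g A = mat_sum N (\<lambda>a. f a + g a) A"
proof (rule eq_matI)
  fix i j assume "i < dim_row (mat_sum N (\<lambda>a. f a + g a) A)" "j < dim_col (mat_sum N (\<lambda>a. f a + g a) A)"
  then have ij: "i < N" "j < N" by (auto simp: mat_sum_def)
  have "(f a + g a) $$ (i, j) = f a $$ (i, j) + g a $$ (i, j)" if "a \<in> A" for a
    using assms(2)[OF that] ij by auto
  then show "(mat_sum N f A + mat_sum N g A) $$ (i, j) = mat_sum N (\<lambda>a. f a + g a) A $$ (i, j)"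
    using ij by (simp add: mat_sum_def sum.distrib)
qed (auto simp: mat_sum_def)

lemma conj_by_add:
  assumes "unitary_mat N U" "A \<in> carrier_mat N N" "B \<in> carrier_mat N N"
  shows "conj_by U (A + B) = conj_by U A + conj_by U B"
proof -
  from assms have c: "U \<in> carrier_mat N N" by (auto simp: unitary_mat_def)
  note ca = mat_adjoint_carrier[OF c]
  show ?thesis
    unfolding conj_by_def using c ca assms(2,3)
    by (simp add: mult_add_distrib_mat[of _ N N] add_mult_distrib_mat[of _ N N _ _ N])
qed

lemma conj_by_mat_sum:
  assumes "unitary_mat N U" "finite A" "\<And>a. a \<in> A \<Longrightarrow> f a \<in> carrier_mat N N"
  shows "conj_by U (mat_sum N f A) = mat_sum N (\<lambda>a. conj_by U (f a)) A"
  using assms(2,3)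
proof (induction A)
  case empty
  from assms have c: "U \<in> carrier_mat N N" by (auto simp: unitary_mat_def)
  note ca = mat_adjoint_carrier[OF c]
  show ?case unfolding mat_sum_empty conj_by_def using c ca
    by (simp add: right_mult_zero_mat[of _ N N] left_mult_zero_mat[of _ N N])
next
  case (insert a A)
  then show ?case
    using assms(1) by (simp add: mat_sum_insert conj_by_add)
qed

lemma conj_by_uminus:
  assumes "unitary_mat N U" "A \<in> carrier_mat N N"
  shows "conj_by U (- A) = - conj_by U A"
proof -
  from assms have c: "U \<in> carrier_mat N N" by (auto simp: unitary_mat_def)
  note ca = mat_adjoint_carrier[OF c]
  show ?thesis
    unfolding conj_by_def using carrier_matD[OF c] carrier_matD[OF ca] carrier_matD[OF assms(2)]
    by simp
qed

section \<open>Geometry of the torus\<close>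

lemma finite_sites [simp]: "finite (sites L)"
  by (simp add: sites_def)

lemma card_sites: "card (sites L) = L\<^sup>2"
  by (simp add: sites_def power2_eq_square)

lemma shift_in_sites [simp]: "L > 0 \<Longrightarrow> shift L d s \<in> sites L"
  by (auto simp: shift_def sites_def)

lemma shift_shift [simp]:
  "shift L d (shift L e s) = shift L (fst d + fst e, snd d + snd e) s"
  by (simp add: shift_def mod_add_right_eq mod_add_left_eq add.commute add.left_commute)

lemma shift_zero [simp]: "s \<in> sites L \<Longrightarrow> shift L (0, 0) s = s"
  by (auto simp: shift_def sites_def)

text \<open>Solving for one site with a combined displacement gives a normal form: conditions
  reached along different paths on the torus become syntactically equal and can cancel.\<close>

lemma shift_eq_iff:
  assumes "s \<in> sites L" "t \<in> sites L"
  shows "shift L d s = shift L e t \<longleftrightarrow> s = shift L (fst e - fst d, snd e - snd d) t"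
proof
  assume "shift L d s = shift L e t"
  then have "shift L (- fst d, - snd d) (shift L d s) = shift L (- fst d, - snd d) (shift L e t)"
    by simp
  then show "s = shift L (fst e - fst d, snd e - snd d) t"
    using assms by simp
next
  assume "s = shift L (fst e - fst d, snd e - snd d) t"
  then have "shift L d s = shift L d (shift L (fst e - fst d, snd e - snd d) t)" by simp
  then show "shift L d s = shift L e t" by simp
qed

lemma shift_eq_iff':
  assumes "s \<in> sites L" "t \<in> sites L"
  shows "shift L d s = t \<longleftrightarrow> s = shift L (- fst d, - snd d) t"
  using shift_eq_iff[OF assms, of d "(0, 0)"] assms by simp

lemma inj_on_shift: "inj_on (shift L d) (sites L)"
  by (rule inj_onI) (simp add: shift_eq_iff)

lemma shift_image [simp]:
  assumes "L > 0"
  shows "shift L d ` sites L = sites L"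
proof (intro equalityI subsetI)
  fix s assume "s \<in> sites L"
  then have "s = shift L d (shift L (- fst d, - snd d) s)" by simp
  then show "s \<in> shift L d ` sites L" using assms by (metis imageI shift_in_sites)
qed (use assms in auto)

lemma bij_betw_shift: "L > 0 \<Longrightarrow> bij_betw (shift L d) (sites L) (sites L)"
  by (simp add: bij_betw_def inj_on_shift)

lemma qubits_simps [simp]:
  "Vertex s \<in> qubits L \<longleftrightarrow> s \<in> sites L" "HEdge s \<in> qubits L \<longleftrightarrow> s \<in> sites L"
  "VEdge s \<in> qubits L \<longleftrightarrow> s \<in> sites L"
  by (auto simp: qubits_def)

lemma site_index_less:
  assumes "s \<in> sites L"
  shows "site_index L s < L\<^sup>2"
proof -
  have *: "nat (fst s) + 1 \<le> L" "nat (snd s) < L" using assms by (auto simp: sites_def)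
  have "site_index L s < (nat (fst s) + 1) * L"
    using *(2) by (simp add: site_index_def)
  also have "\<dots> \<le> L * L" by (rule mult_right_mono) (use * in auto)
  finally show ?thesis by (simp add: power2_eq_square)
qed

lemma inj_on_site_index: "inj_on (site_index L) (sites L)"
proof (rule inj_onI)
  fix s t assume st: "s \<in> sites L" "t \<in> sites L" "site_index L s = site_index L t"
  then have "nat (snd s) < L" "nat (snd t) < L" by (auto simp: sites_def)
  moreover from this have "nat (fst s) = site_index L s div L" "nat (snd s) = site_index L s mod L"
    "nat (fst t) = site_index L t div L" "nat (snd t) = site_index L t mod L"
    by (auto simp: site_index_def)
  ultimately have "nat (fst s) = nat (fst t)" "nat (snd s) = nat (snd t)" using st(3) by auto
  then show "s = t" using st(1,2) by (auto simp: sites_def)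
qed

lemma site_index_image: "site_index L ` sites L = {..<L\<^sup>2}"
  by (rule card_subset_eq)
    (auto simp: site_index_less card_image[OF inj_on_site_index] card_sites)

lemma site_index_eq_iff:
  "s \<in> sites L \<Longrightarrow> t \<in> sites L \<Longrightarrow> site_index L s = site_index L t \<longleftrightarrow> s = t"
  using inj_on_site_index[of L] by (auto dest: inj_onD)

lemma idx_eq_iff:
  assumes "q \<in> qubits L" "r \<in> qubits L"
  shows "idx L q = idx L r \<longleftrightarrow> q = r"
proof (cases q)
  fix s assume q: "q = Vertex s"
  have "site_index L s < L\<^sup>2" using assms q by (simp add: site_index_less)
  then show ?thesis using assms q by (cases r) (auto simp: site_index_eq_iff)
next
  fix s assume q: "q = HEdge s"
  have s: "site_index L s < L\<^sup>2" using assms q by (simp add: site_index_less)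
  show ?thesis
  proof (cases r)
    case (Vertex t)
    then show ?thesis using s assms q site_index_less[of t L] by auto
  next
    case (VEdge t)
    then show ?thesis using s assms q site_index_less[of t L] by auto
  qed (use assms q in \<open>auto simp: site_index_eq_iff\<close>)
next
  fix s assume q: "q = VEdge s"
  have s: "site_index L s < L\<^sup>2" using assms q by (simp add: site_index_less)
  show ?thesis
  proof (cases r)
    case (Vertex t)
    then show ?thesis using s assms q site_index_less[of t L] by auto
  next
    case (HEdge t)
    then show ?thesis using s assms q site_index_less[of t L] by auto
  qed (use assms q in \<open>auto simp: site_index_eq_iff\<close>)
qed

lemma idx_less: "q \<in> qubits L \<Longrightarrow> idx L q < 3 * L\<^sup>2"
  by (cases q) (auto dest!: site_index_less)

lemma idx_less_top: "q \<in> qubits L \<Longrightarrow> idx L q < 2 * L\<^sup>2 \<longleftrightarrow> (\<forall>s. q \<noteq> HEdge s)"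
  by (cases q) (auto dest!: site_index_less)

text \<open>Transports a set of lattice qubits to the numbering. Numbers that index no lattice qubit
  are left out, so the transport commutes with symmetric differences without any range
  condition.\<close>

definition at_idx :: "nat \<Rightarrow> (qubit \<Rightarrow> bool) \<Rightarrow> nat \<Rightarrow> bool" where
  "at_idx L s j \<longleftrightarrow> (\<exists>q\<in>qubits L. idx L q = j \<and> s q)"

lemma at_idx_cong: "(\<And>q. q \<in> qubits L \<Longrightarrow> s q = t q) \<Longrightarrow> at_idx L s = at_idx L t"
  by (auto simp: at_idx_def fun_eq_iff)

lemma at_idx_idx [simp]: "q \<in> qubits L \<Longrightarrow> at_idx L s (idx L q) = s q"
  by (auto simp: at_idx_def idx_eq_iff)

lemma at_idx_xor: "(\<lambda>j. at_idx L s j \<noteq> at_idx L t j) = at_idx L (\<lambda>q. s q \<noteq> t q)"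
proof
  fix j
  show "(at_idx L s j \<noteq> at_idx L t j) = at_idx L (\<lambda>q. s q \<noteq> t q) j"
  proof (cases "j \<in> idx L ` qubits L")
    case False
    then show ?thesis by (auto simp: at_idx_def)
  qed auto
qed

lemma at_idx_upd: "b \<in> qubits L \<Longrightarrow> (at_idx L s)(idx L b := v) = at_idx L (s(b := v))"
  by (auto simp: at_idx_def fun_eq_iff idx_eq_iff)

lemma at_idx_single: "q \<in> qubits L \<Longrightarrow> at_idx L (\<lambda>r. r = q) = (\<lambda>j. j = idx L q)"
  by (auto simp: at_idx_def)

section \<open>Rounds of CNOT gates\<close>

definition xq :: "nat \<Rightarrow> (qubit \<Rightarrow> bool) \<Rightarrow> complex mat" where
  "xq L s = xstr (3 * L\<^sup>2) (at_idx L s)"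

definition zq :: "nat \<Rightarrow> (qubit \<Rightarrow> bool) \<Rightarrow> complex mat" where
  "zq L s = zstr (3 * L\<^sup>2) (at_idx L s)"

lemma xq_carrier [simp]: "xq L s \<in> carrier_mat (2 ^ (3 * L\<^sup>2)) (2 ^ (3 * L\<^sup>2))"
  and zq_carrier [simp]: "zq L s \<in> carrier_mat (2 ^ (3 * L\<^sup>2)) (2 ^ (3 * L\<^sup>2))"
  by (simp_all add: xq_def zq_def)

lemma xq_cong: "(\<And>q. q \<in> qubits L \<Longrightarrow> s q = t q) \<Longrightarrow> xq L s = xq L t"
  and zq_cong: "(\<And>q. q \<in> qubits L \<Longrightarrow> s q = t q) \<Longrightarrow> zq L s = zq L t"
  unfolding xq_def zq_def using at_idx_cong[of L s t] by simp_all

lemma xq_mult: "xq L s * xq L t = xq L (\<lambda>q. s q \<noteq> t q)"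
  and zq_mult: "zq L s * zq L t = zq L (\<lambda>q. s q \<noteq> t q)"
  by (simp_all only: xq_def zq_def xstr_mult zstr_mult at_idx_xor)

lemma pauli_X_eq: "q \<in> qubits L \<Longrightarrow> pauli_X L q = xq L (\<lambda>r. r = q)"
  and pauli_Z_eq: "q \<in> qubits L \<Longrightarrow> pauli_Z L q = zq L (\<lambda>r. r = q)"
  by (simp_all add: pauli_X_def pauli_Z_def xq_def zq_def on_qubit_sigma_x on_qubit_sigma_z
      idx_less at_idx_single)

definition valid_gates :: "nat \<Rightarrow> (qubit \<times> qubit) list \<Rightarrow> bool" where
  "valid_gates L gs \<longleftrightarrow> (\<forall>(a, b) \<in> set gs. a \<in> qubits L \<and> b \<in> qubits L \<and> a \<noteq> b)"

lemma cnot_product_Cons: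
  "cnot_product L ((a, b) # gs) = cnot (3 * L\<^sup>2) (idx L a) (idx L b) * cnot_product L gs"
  by (simp add: cnot_product_def)

lemma unitary_cnot_product:
  "valid_gates L gs \<Longrightarrow> unitary_mat (2 ^ (3 * L\<^sup>2)) (cnot_product L gs)"
proof (induction gs)
  case Nil
  then show ?case by (simp add: cnot_product_def unitary_one_mat)
next
  case (Cons g gs)
  then show ?case
    by (cases g) (auto simp: valid_gates_def cnot_product_Cons idx_eq_iff idx_less
        intro!: unitary_mat_mult unitary_cnot)
qed

lemma conj_by_cnot_xq:
  assumes "a \<in> qubits L" "b \<in> qubits L" "a \<noteq> b"
  shows "conj_by (cnot (3 * L\<^sup>2) (idx L a) (idx L b)) (xq L s) = xq L (s(b := (s b \<noteq> s a)))"
  by (rule conj_by_eqI[OF unitary_cnot])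
    (use assms cnot_xstr[of "idx L a" "idx L b" "3 * L\<^sup>2" "at_idx L s"]
      in \<open>auto simp: idx_eq_iff idx_less xq_def at_idx_upd\<close>)

lemma conj_by_cnot_zq:
  assumes "a \<in> qubits L" "b \<in> qubits L" "a \<noteq> b"
  shows "conj_by (cnot (3 * L\<^sup>2) (idx L a) (idx L b)) (zq L s) = zq L (s(a := (s a \<noteq> s b)))"
  by (rule conj_by_eqI[OF unitary_cnot])
    (use assms cnot_zstr[of "idx L a" "idx L b" "3 * L\<^sup>2" "at_idx L s"]
      in \<open>auto simp: idx_eq_iff idx_less zq_def at_idx_upd\<close>)

lemma conj_by_one_mat: "A \<in> carrier_mat N N \<Longrightarrow> conj_by (1\<^sub>m N) A = A"
  by (rule conj_by_eqI[OF unitary_one_mat]) auto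

lemma conj_by_cnot_product_xq:
  "valid_gates L gs \<Longrightarrow> conj_by (cnot_product L gs) (xq L s) =
    xq L (foldr (\<lambda>(a, b) s. s(b := (s b \<noteq> s a))) gs s)"
proof (induction gs)
  case Nil
  then show ?case by (simp add: cnot_product_def conj_by_one_mat)
next
  case (Cons g gs)
  obtain a b where g: "g = (a, b)" by (cases g)
  from Cons.prems g have "a \<in> qubits L" "b \<in> qubits L" "a \<noteq> b" "valid_gates L gs"
    by (auto simp: valid_gates_def)
  then show ?case
    using Cons.IH[OF \<open>valid_gates L gs\<close>] unfolding g cnot_product_Cons
    by (subst conj_by_compose[of "2 ^ (3 * L\<^sup>2)"])
      (simp_all del: fun_upd_apply add: unitary_cnot unitary_cnot_product idx_eq_iff idx_less conj_by_cnot_xq)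
qed

lemma conj_by_cnot_product_zq:
  "valid_gates L gs \<Longrightarrow> conj_by (cnot_product L gs) (zq L s) =
    zq L (foldr (\<lambda>(a, b) s. s(a := (s a \<noteq> s b))) gs s)"
proof (induction gs)
  case Nil
  then show ?case by (simp add: cnot_product_def conj_by_one_mat)
next
  case (Cons g gs)
  obtain a b where g: "g = (a, b)" by (cases g)
  from Cons.prems g have "a \<in> qubits L" "b \<in> qubits L" "a \<noteq> b" "valid_gates L gs"
    by (auto simp: valid_gates_def)
  then show ?case
    using Cons.IH[OF \<open>valid_gates L gs\<close>] unfolding g cnot_product_Cons
    by (subst conj_by_compose[of "2 ^ (3 * L\<^sup>2)"])
      (simp_all del: fun_upd_apply add: unitary_cnot unitary_cnot_product idx_eq_iff idx_less conj_by_cnot_zq)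
qed

text \<open>The effect of a whole round on supports. The existential stands for a sum modulo 2 over
  all gates, which is correct because an injective \<open>\<beta>\<close> leaves at most one summand
  at each \<open>q\<close>.\<close>

definition add_along :: "nat \<Rightarrow> (site \<Rightarrow> qubit) \<Rightarrow> (site \<Rightarrow> qubit) \<Rightarrow> (qubit \<Rightarrow> bool) \<Rightarrow> qubit \<Rightarrow> bool" where
  "add_along L \<alpha> \<beta> s q \<longleftrightarrow> s q \<noteq> (\<exists>p\<in>sites L. q = \<beta> p \<and> s (\<alpha> p))"

text \<open>No source is ever a target, so every update still reads an original value, and distinct
  targets keep the updates from overwriting one another. Sequential and simultaneous addition
  therefore agree.\<close>

lemma foldr_upd_disjoint:
  assumes "distinct ps" "inj_on \<beta> (set ps)" "\<And>p p'. p \<in> set ps \<Longrightarrow> p' \<in> set ps \<Longrightarrow> \<alpha> p \<noteq> \<beta> p'"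
  shows "foldr (\<lambda>p s. s(\<beta> p := (s (\<beta> p) \<noteq> s (\<alpha> p)))) ps s =
    (\<lambda>q. s q \<noteq> (\<exists>p\<in>set ps. q = \<beta> p \<and> s (\<alpha> p)))"
  using assms
proof (induction ps)
  case (Cons p ps)
  then have IH: "foldr (\<lambda>p s. s(\<beta> p := (s (\<beta> p) \<noteq> s (\<alpha> p)))) ps s =
      (\<lambda>q. s q \<noteq> (\<exists>p\<in>set ps. q = \<beta> p \<and> s (\<alpha> p)))"
    by (simp del: fun_upd_apply)
  have n: "\<beta> p \<noteq> \<beta> p'" "\<alpha> p \<noteq> \<beta> p'" if "p' \<in> set ps" for p'
    using Cons.prems that by (auto simp: inj_on_def)
  show ?case
    unfolding foldr_Cons o_apply IH using n by (auto simp: fun_eq_iff)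
qed simp

definition gates :: "(site \<Rightarrow> qubit) \<Rightarrow> (site \<Rightarrow> qubit) \<Rightarrow> site list \<Rightarrow> (qubit \<times> qubit) list" where
  "gates \<alpha> \<beta> ps = map (\<lambda>p. (\<alpha> p, \<beta> p)) ps"

text \<open>The last assumption compares all controls with all targets, not only those of one gate.
  Together with injectivity it makes the gates disjoint, and it is what
  \<open>foldr_upd_disjoint\<close> requires in both directions of travel.\<close>

locale translation_round =
  fixes L :: nat and ps :: "site list" and \<alpha> \<beta> :: "site \<Rightarrow> qubit"
  assumes pos: "L > 0"
    and ps: "distinct ps" "set ps = sites L"
    and inj: "inj_on \<alpha> (sites L)" "inj_on \<beta> (sites L)"
    and in_qubits: "\<And>p. p \<in> sites L \<Longrightarrow> \<alpha> p \<in> qubits L" "\<And>p. p \<in> sites L \<Longrightarrow> \<beta> p \<in> qubits L"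
    and control_ne_target: "\<And>p p'. p \<in> sites L \<Longrightarrow> p' \<in> sites L \<Longrightarrow> \<alpha> p \<noteq> \<beta> p'"
begin

lemma valid: "valid_gates L (gates \<alpha> \<beta> ps)"
  using in_qubits control_ne_target by (auto simp: valid_gates_def gates_def ps)

lemma unitary: "unitary_mat (2 ^ (3 * L\<^sup>2)) (cnot_product L (gates \<alpha> \<beta> ps))"
  by (rule unitary_cnot_product[OF valid])

lemma conj_xq: "conj_by (cnot_product L (gates \<alpha> \<beta> ps)) (xq L s) = xq L (add_along L \<alpha> \<beta> s)"
proof -
  have "foldr (\<lambda>(a, b) s. s(b := (s b \<noteq> s a))) (gates \<alpha> \<beta> ps) s =
      foldr (\<lambda>p s. s(\<beta> p := (s (\<beta> p) \<noteq> s (\<alpha> p)))) ps s"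
    by (simp add: gates_def foldr_map o_def)
  also have "\<dots> = add_along L \<alpha> \<beta> s"
    using control_ne_target inj
    by (subst foldr_upd_disjoint[of ps \<beta> \<alpha> s]) (simp_all add: ps add_along_def fun_eq_iff)
  finally show ?thesis by (simp add: conj_by_cnot_product_xq[OF valid])
qed

lemma conj_zq: "conj_by (cnot_product L (gates \<alpha> \<beta> ps)) (zq L s) = zq L (add_along L \<beta> \<alpha> s)"
proof -
  have "foldr (\<lambda>(a, b) s. s(a := (s a \<noteq> s b))) (gates \<alpha> \<beta> ps) s =
      foldr (\<lambda>p s. s(\<alpha> p := (s (\<alpha> p) \<noteq> s (\<beta> p)))) ps s"
    by (simp add: gates_def foldr_map o_def)
  also have "\<dots> = add_along L \<beta> \<alpha> s"
    using control_ne_target[symmetric] inj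
    by (subst foldr_upd_disjoint[of ps \<alpha> \<beta> s]) (simp_all add: ps add_along_def fun_eq_iff)
  finally show ?thesis by (simp add: conj_by_cnot_product_zq[OF valid])
qed

lemma cnot_round_gates:
  assumes "\<And>p. p \<in> sites L \<Longrightarrow> lattice_dist L (\<alpha> p) (\<beta> p) \<le> c"
    and "\<And>d p. p \<in> sites L \<Longrightarrow> translate L d (\<alpha> p) = \<alpha> (shift L d p)"
    and "\<And>d p. p \<in> sites L \<Longrightarrow> translate L d (\<beta> p) = \<beta> (shift L d p)"
  shows "cnot_round L c (gates \<alpha> \<beta> ps)"
proof -
  have "distinct (gates \<alpha> \<beta> ps)"
    unfolding gates_def distinct_map ps(2) using ps(1) inj(1) by (simp add: inj_on_def)
  moreover have "length (gates \<alpha> \<beta> ps) = L\<^sup>2"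
    using ps distinct_card[of ps] by (simp add: gates_def card_sites)
  moreover have "pairwise (\<lambda>(a, b) (a', b'). {a, b} \<inter> {a', b'} = {}) (set (gates \<alpha> \<beta> ps))"
    unfolding pairwise_def
  proof (intro ballI impI)
    fix g g' assume gg: "g \<in> set (gates \<alpha> \<beta> ps)" "g' \<in> set (gates \<alpha> \<beta> ps)" "g \<noteq> g'"
    then obtain p p' where p: "g = (\<alpha> p, \<beta> p)" "g' = (\<alpha> p', \<beta> p')" "p \<in> sites L" "p' \<in> sites L" "p \<noteq> p'"
      by (auto simp: gates_def ps)
    then have "\<alpha> p \<noteq> \<alpha> p'" "\<beta> p \<noteq> \<beta> p'" "\<alpha> p \<noteq> \<beta> p'" "\<alpha> p' \<noteq> \<beta> p"
      using inj control_ne_target by (auto dest: inj_onD)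
    then show "(\<lambda>(a, b) (a', b'). {a, b} \<inter> {a', b'} = {}) g g'"
      using p by auto
  qed
  moreover have "(\<lambda>(a, b). (translate L d a, translate L d b)) ` set (gates \<alpha> \<beta> ps) =
      set (gates \<alpha> \<beta> ps)" for d
  proof -
    have "(\<lambda>(a, b). (translate L d a, translate L d b)) ` set (gates \<alpha> \<beta> ps) =
        (\<lambda>p. (\<alpha> (shift L d p), \<beta> (shift L d p))) ` sites L"
      unfolding gates_def set_map ps(2) image_image by (rule image_cong) (simp_all add: assms(2,3))
    also have "\<dots> = (\<lambda>p. (\<alpha> p, \<beta> p)) ` (shift L d ` sites L)"
      by (simp only: image_image)
    finally show ?thesis using pos by (simp add: gates_def ps)
  qed
  moreover have "\<forall>(a, b)\<in>set (gates \<alpha> \<beta> ps). a \<in> qubits L \<and> b \<in> qubits L \<and> a \<noteq> b \<and> lattice_dist L a b \<le> c"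
    using in_qubits control_ne_target assms(1) by (auto simp: gates_def ps)
  ultimately show ?thesis by (simp add: cnot_round_def)
qed

end

section \<open>The disentangling circuit\<close>

lemma cyclic_abs_le:
  assumes "m > 0"
  shows "cyclic_abs m a \<le> \<bar>a\<bar>"
proof (cases "a \<ge> 0")
  case True
  then have "a mod m \<le> a" by (rule zmod_le_nonneg_dividend)
  then show ?thesis using True by (simp add: cyclic_abs_def)
next
  case False
  then have "(- a) mod m \<le> - a" by (intro zmod_le_nonneg_dividend) simp
  then show ?thesis using False by (simp add: cyclic_abs_def)
qed

lemma cyclic_abs_cong: "a mod m = b mod m \<Longrightarrow> cyclic_abs m a = cyclic_abs m b"
  unfolding cyclic_abs_def by (metis mod_minus_cong)

text \<open>Doubling turns the reduction modulo \<open>L\<close> of a site coordinate into a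
  reduction modulo \<open>2 * L\<close>, so the wrap-around vanishes in the difference. In half
  spacings a site lies one unit east of the centre of the edge to its west, also across the
  seam.\<close>

lemma cyclic_abs_double_shift:
  "cyclic_abs (2 * int L) (2 * x - (2 * ((x - 1) mod int L) + 1)) = cyclic_abs (2 * int L) 1"
proof (rule cyclic_abs_cong)
  have "(2 * x - (2 * ((x - 1) mod int L) + 1)) mod (2 * int L) =
      (2 * x - 1 - (2 * (x - 1)) mod (2 * int L)) mod (2 * int L)"
    by (simp add: mult_mod_right algebra_simps)
  also have "\<dots> = 1 mod (2 * int L)"
    unfolding mod_diff_right_eq by simp
  finally show "(2 * x - (2 * ((x - 1) mod int L) + 1)) mod (2 * int L) = 1 mod (2 * int L)" .
qed

text \<open>The centre of a horizontal edge is half a spacing from its end vertices, and half a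
  spacing in each direction from the vertical edges above them, which makes 1 in the Manhattan
  metric. This is the constant of the theorem.\<close>

lemma lattice_dist_gates:
  assumes "p \<in> sites L" "L > 0"
  shows "lattice_dist L (HEdge p) (Vertex p) \<le> 1"
    and "lattice_dist L (HEdge p) (VEdge p) \<le> 1"
    and "lattice_dist L (Vertex p) (HEdge (shift L (- 1, 0) p)) \<le> 1"
    and "lattice_dist L (VEdge p) (HEdge (shift L (- 1, 0) p)) \<le> 1"
proof -
  obtain x y where p: "p = (x, y)" by (cases p)
  have y: "y mod int L = y" using assms p by (auto simp: sites_def)
  note le = cyclic_abs_le[of "2 * int L" 0] cyclic_abs_le[of "2 * int L" 1]
    cyclic_abs_le[of "2 * int L" "- 1"]
  show "lattice_dist L (HEdge p) (Vertex p) \<le> 1" "lattice_dist L (HEdge p) (VEdge p) \<le> 1"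
    using le assms(2) by (simp_all add: lattice_dist_def p)
  show "lattice_dist L (Vertex p) (HEdge (shift L (- 1, 0) p)) \<le> 1"
    "lattice_dist L (VEdge p) (HEdge (shift L (- 1, 0) p)) \<le> 1"
    using le assms(2) cyclic_abs_double_shift[of L x]
    by (simp_all add: lattice_dist_def p shift_def y)
qed

text \<open>Translation is invertible, so the existential of \<open>add_along\<close> has a single
  candidate, the site shifted back.\<close>

lemma bex_shift:
  assumes "u \<in> sites L" "L > 0"
  shows "(\<exists>p\<in>sites L. u = shift L d p \<and> P p) \<longleftrightarrow> P (shift L (- fst d, - snd d) u)"
proof
  assume "\<exists>p\<in>sites L. u = shift L d p \<and> P p"
  then show "P (shift L (- fst d, - snd d) u)" by auto
next
  assume "P (shift L (- fst d, - snd d) u)"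
  moreover have "u = shift L d (shift L (- fst d, - snd d) u)" using assms by simp
  ultimately show "\<exists>p\<in>sites L. u = shift L d p \<and> P p" using assms(2) by (metis shift_in_sites)
qed

lemma shift_ne_self:
  assumes "L \<ge> 2" "s \<in> sites L"
  shows "shift L (1, 0) s \<noteq> s" "shift L (0, 1) s \<noteq> s"
proof -
  have *: "(a + 1) mod int L \<noteq> a" if "0 \<le> a" "a < int L" for a
    using that assms(1) by (cases "a + 1 = int L") auto
  obtain x y where s: "s = (x, y)" by (cases s)
  then show "shift L (1, 0) s \<noteq> s" "shift L (0, 1) s \<noteq> s"
    using assms *[of x] *[of y] by (auto simp: shift_def sites_def)
qed

section \<open>Supports before and after the circuit\<close>

definition in_triangle :: "triangle \<Rightarrow> qubit \<Rightarrow> bool" where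
  "in_triangle T q \<longleftrightarrow> (case T of (u, f, g) \<Rightarrow> q = u \<or> q = f \<or> q = g)"

text \<open>In the last case the vertex and the vertical edge have both received the value of their
  own horizontal edge beforehand; the two copies cancel, and only original values remain.\<close>

fun push_X :: "nat \<Rightarrow> (qubit \<Rightarrow> bool) \<Rightarrow> qubit \<Rightarrow> bool" where
  "push_X L s (Vertex u) = (s (Vertex u) \<noteq> s (HEdge u))"
| "push_X L s (VEdge u) = (s (VEdge u) \<noteq> s (HEdge u))"
| "push_X L s (HEdge u) =
    (s (HEdge u) \<noteq> (s (Vertex (shift L (1, 0) u)) \<noteq> s (VEdge (shift L (1, 0) u))))"

text \<open>The value that a horizontal edge holds once the first two rounds have acted on a Z
  string.\<close>

definition site_parity :: "(qubit \<Rightarrow> bool) \<Rightarrow> site \<Rightarrow> bool" where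
  "site_parity s u = (s (HEdge u) \<noteq> (s (Vertex u) \<noteq> s (VEdge u)))"

fun push_Z :: "nat \<Rightarrow> (qubit \<Rightarrow> bool) \<Rightarrow> qubit \<Rightarrow> bool" where
  "push_Z L s (HEdge u) = site_parity s u"
| "push_Z L s (Vertex u) = (s (Vertex u) \<noteq> site_parity s (shift L (- 1, 0) u))"
| "push_Z L s (VEdge u) = (s (VEdge u) \<noteq> site_parity s (shift L (- 1, 0) u))"

fun star_X :: "nat \<Rightarrow> site \<Rightarrow> qubit \<Rightarrow> bool" where
  "star_X L v (Vertex u) = ((u = v) \<noteq> (u = shift L (- 1, 0) v))"
| "star_X L v (VEdge u) = ((u = shift L (0, - 1) v) \<noteq> (u = shift L (- 1, 0) v))"
| "star_X L v (HEdge u) = False"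

fun face_Z :: "nat \<Rightarrow> site \<Rightarrow> qubit \<Rightarrow> bool" where
  "face_Z L f (Vertex u) = ((u = f) \<noteq> (u = shift L (1, - 1) f))"
| "face_Z L f (VEdge u) = ((u = shift L (0, - 1) f) \<noteq> (u = shift L (1, - 1) f))"
| "face_Z L f (HEdge u) = False"

locale torus =
  fixes L :: nat and ps :: "site list"
  assumes L: "L \<ge> 2" and ps: "distinct ps" "set ps = sites L"
begin

lemma pos [simp]: "L > 0" using L by simp

abbreviation "west p \<equiv> HEdge (shift L (- 1, 0) p)"

sublocale r1: translation_round L ps HEdge Vertex
  by unfold_locales (auto simp: ps inj_on_def)

sublocale r2: translation_round L ps HEdge VEdge
  by unfold_locales (auto simp: ps inj_on_def)

sublocale r3: translation_round L ps Vertex west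
  by unfold_locales (auto simp: ps inj_on_def shift_eq_iff)

sublocale r4: translation_round L ps VEdge west
  by unfold_locales (auto simp: ps inj_on_def shift_eq_iff)

lemma cnot_rounds:
  "cnot_round L 1 (gates HEdge Vertex ps)" "cnot_round L 1 (gates HEdge VEdge ps)"
  "cnot_round L 1 (gates Vertex west ps)" "cnot_round L 1 (gates VEdge west ps)"
  by (rule r1.cnot_round_gates r2.cnot_round_gates r3.cnot_round_gates r4.cnot_round_gates;
      simp add: lattice_dist_gates add.commute)+

definition U :: "complex mat" where
  "U = cnot_product L (gates VEdge west ps) * cnot_product L (gates Vertex west ps) *
    cnot_product L (gates HEdge VEdge ps) * cnot_product L (gates HEdge Vertex ps)"

lemma unitary_U: "unitary_mat (2 ^ (3 * L\<^sup>2)) U"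
  unfolding U_def by (intro unitary_mat_mult r1.unitary r2.unitary r3.unitary r4.unitary)

lemma conj_U:
  assumes "A \<in> carrier_mat (2 ^ (3 * L\<^sup>2)) (2 ^ (3 * L\<^sup>2))"
  shows "conj_by U A = conj_by (cnot_product L (gates VEdge west ps))
    (conj_by (cnot_product L (gates Vertex west ps))
    (conj_by (cnot_product L (gates HEdge VEdge ps))
    (conj_by (cnot_product L (gates HEdge Vertex ps)) A)))"
proof -
  note u = r1.unitary r2.unitary r3.unitary r4.unitary
  show ?thesis
    unfolding U_def
    by (subst conj_by_compose[of "2 ^ (3 * L\<^sup>2)"] conj_by_carrier;
        (intro unitary_mat_mult conj_by_carrier u assms)?)+ simp?
qed

lemma conj_U_xq: "conj_by U (xq L s) = xq L (push_X L s)"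
proof -
  have "conj_by U (xq L s) = xq L (add_along L VEdge west (add_along L Vertex west
      (add_along L HEdge VEdge (add_along L HEdge Vertex s))))"
    by (simp add: conj_U r1.conj_xq r2.conj_xq r3.conj_xq r4.conj_xq)
  also have "\<dots> = xq L (push_X L s)"
  proof (rule xq_cong)
    fix q assume "q \<in> qubits L"
    then show "add_along L VEdge west (add_along L Vertex west
      (add_along L HEdge VEdge (add_along L HEdge Vertex s))) q = push_X L s q"
      by (cases q) (auto simp: add_along_def bex_shift)
  qed
  finally show ?thesis .
qed

lemma conj_U_zq: "conj_by U (zq L s) = zq L (push_Z L s)"
proof -
  have "conj_by U (zq L s) = zq L (add_along L west VEdge (add_along L west Vertex
      (add_along L VEdge HEdge (add_along L Vertex HEdge s))))"
    by (simp add: conj_U r1.conj_zq r2.conj_zq r3.conj_zq r4.conj_zq)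
  also have "\<dots> = zq L (push_Z L s)"
  proof (rule zq_cong)
    fix q assume "q \<in> qubits L"
    then show "add_along L west VEdge (add_along L west Vertex
      (add_along L VEdge HEdge (add_along L Vertex HEdge s))) q = push_Z L s q"
      by (cases q) (auto simp: add_along_def bex_shift site_parity_def)
  qed
  finally show ?thesis .
qed

lemma G_X:
  assumes "p \<in> sites L"
  shows "G L (T_SW L p) = xq L (in_triangle (T_SW L p))"
    and "G L (T_NE L p) = xq L (in_triangle (T_NE L p))"
  using assms
  by (auto simp: G_def T_SW_def T_NE_def in_triangle_def pauli_X_eq xq_mult intro!: xq_cong)

text \<open>On a torus of side 1 all four triangles coincide; \<open>L \<ge> 2\<close> excludes this
  through \<open>shift_ne_self\<close>. Since \<open>G\<close> decides between X and Z by membership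
  in the south-west and north-east families, the separation is what makes the other two families of
  Z type.\<close>

lemma triangles_distinct:
  assumes "p \<in> sites L" "p' \<in> sites L"
  shows "T_SW L p \<noteq> T_SE L p'" "T_SW L p \<noteq> T_NW L p'" "T_SW L p \<noteq> T_NE L p'"
    "T_SE L p \<noteq> T_NW L p'" "T_SE L p \<noteq> T_NE L p'" "T_NW L p \<noteq> T_NE L p'"
  using assms shift_ne_self[OF L, of p'] shift_ne_self[OF L, of "shift L (0, 1) p'"]
    shift_ne_self[OF L, of "shift L (1, 0) p'"]
  by (auto simp: T_SW_def T_SE_def T_NW_def T_NE_def shift_eq_iff)

lemma triangle_images_disjoint:
  "T_SE L ` sites L \<inter> (T_SW L ` sites L \<union> T_NE L ` sites L) = {}"
  "T_NW L ` sites L \<inter> (T_SW L ` sites L \<union> T_NE L ` sites L) = {}"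
  "T_SW L ` sites L \<inter> T_NE L ` sites L = {}"
  "T_SE L ` sites L \<inter> T_NW L ` sites L = {}"
  by (simp_all add: disjoint_iff image_iff) (metis triangles_distinct)+

lemma inj_triangles:
  "inj_on (T_SW L) (sites L)" "inj_on (T_SE L) (sites L)"
  "inj_on (T_NW L) (sites L)" "inj_on (T_NE L) (sites L)"
  by (auto simp: T_SW_def T_SE_def T_NW_def T_NE_def shift_eq_iff inj_on_def)

lemma G_Z:
  assumes "p \<in> sites L"
  shows "G L (T_SE L p) = zq L (in_triangle (T_SE L p))"
    and "G L (T_NW L p) = zq L (in_triangle (T_NW L p))"
proof -
  have "T_SE L p \<notin> T_SW L ` sites L \<union> T_NE L ` sites L"
    "T_NW L p \<notin> T_SW L ` sites L \<union> T_NE L ` sites L"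
    using assms triangle_images_disjoint(1,2) by blast+
  then show "G L (T_SE L p) = zq L (in_triangle (T_SE L p))"
    "G L (T_NW L p) = zq L (in_triangle (T_NW L p))"
    using assms
    by (auto simp: G_def T_SE_def T_NW_def in_triangle_def pauli_Z_eq zq_mult intro!: zq_cong)
qed

text \<open>The horizontal edge leaves the vertex to the east or to the west, the vertical edge to
  the north or to the south, and the four combinations are the four corners of a plaquette.\<close>

lemma triangles_eq:
  "triangles L = T_SW L ` sites L \<union> T_NE L ` sites L \<union> (T_SE L ` sites L \<union> T_NW L ` sites L)"
proof (intro equalityI subsetI)
  fix T assume "T \<in> triangles L"
  then obtain u s t where T: "T = (Vertex u, HEdge s, VEdge t)"
    "u \<in> sites L" "s \<in> sites L" "t \<in> sites L"
    "u = s \<or> u = shift L (1, 0) s" "u = t \<or> u = shift L (0, 1) t"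
    unfolding triangles_def mem_Collect_eq by blast
  then consider "u = s" "u = t" | "u = shift L (1, 0) s" "u = t" | "u = s" "u = shift L (0, 1) t"
    | "u = shift L (1, 0) s" "u = shift L (0, 1) t"
    by blast
  then show "T \<in> T_SW L ` sites L \<union> T_NE L ` sites L \<union> (T_SE L ` sites L \<union> T_NW L ` sites L)"
  proof cases
    case 1
    then have "T = T_SW L u" using T by (simp add: T_SW_def)
    then show ?thesis using T by blast
  next
    case 2
    then have "T = T_SE L s" using T by (simp add: T_SE_def)
    then show ?thesis using T by blast
  next
    case 3
    then have "T = T_NW L t" using T by (simp add: T_NW_def)
    then show ?thesis using T by blast
  next
    case 4
    \<comment> \<open>The horizontal edge at \<open>s\<close> is now the top edge of the plaquette,
      so the plaquette is named by the site below \<open>s\<close>.\<close>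
    define p where "p = shift L (0, - 1) s"
    have "p \<in> sites L" "s = shift L (0, 1) p" "t = shift L (1, 0) p"
      using 4 T by (auto simp: p_def shift_eq_iff)
    then have "T = T_NE L p" using T 4 by (simp add: T_NE_def)
    then show ?thesis using \<open>p \<in> sites L\<close> by blast
  qed
next
  fix T
  have *: "(Vertex u, HEdge s, VEdge t) \<in> triangles L"
    if "u \<in> sites L" "s \<in> sites L" "t \<in> sites L"
      "u = s \<or> u = shift L (1, 0) s" "u = t \<or> u = shift L (0, 1) t" for u s t
    using that unfolding triangles_def by blast
  assume "T \<in> T_SW L ` sites L \<union> T_NE L ` sites L \<union> (T_SE L ` sites L \<union> T_NW L ` sites L)"
  then show "T \<in> triangles L"
    unfolding T_SW_def T_NE_def T_SE_def T_NW_def by (elim UnE imageE) (simp_all add: *)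
qed

lemma J_eq:
  assumes "p \<in> sites L"
  shows "J_X L p = xq L (\<lambda>q. q = HEdge p)" "J_Z L p = zq L (\<lambda>q. q = HEdge p)"
  using assms by (simp_all add: J_X_def J_Z_def pauli_X_eq pauli_Z_eq)

lemma conj_U_bar:
  assumes "p \<in> sites L"
  shows "conj_by U (X_bar L p) = J_X L p" "conj_by U (Z_bar L p) = J_Z L p"
proof -
  have "push_X L (in_triangle (T_SW L p)) q = (q = HEdge p)" if "q \<in> qubits L" for q
    using that assms by (cases q) (auto simp: in_triangle_def T_SW_def)
  then show "conj_by U (X_bar L p) = J_X L p"
    using assms by (auto simp: X_bar_def G_X J_eq conj_U_xq intro!: xq_cong)
  have "push_Z L (in_triangle (T_SE L p)) q = (q = HEdge p)" if "q \<in> qubits L" for q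
    using that assms by (cases q) (auto simp: in_triangle_def site_parity_def T_SE_def shift_eq_iff shift_eq_iff')
  then show "conj_by U (Z_bar L p) = J_Z L p"
    using assms by (auto simp: Z_bar_def G_Z J_eq conj_U_zq intro!: zq_cong)
qed

text \<open>For X, the bottom edge erases the vertex and the vertical edge of the south-west corner,
  while the top edge is copied onto the vertex and the vertical edge at its west end; the last two
  rounds then clear both horizontal edges. For Z, every site meets the support in an even number of
  qubits, so all site parities vanish: the horizontal edges drop out and the other qubits stay as
  they are.\<close>

lemma conj_U_stabilizers:
  assumes "p \<in> sites L"
  shows "conj_by U (S_X L p) = xq L (star_X L (shift L (1, 1) p))"
    and "conj_by U (S_Z L p) = zq L (face_Z L (shift L (0, 1) p))"
proof -
  have "push_X L (\<lambda>q. in_triangle (T_SW L p) q \<noteq> in_triangle (T_NE L p) q) q =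
      star_X L (shift L (1, 1) p) q" if "q \<in> qubits L" for q
    using that assms
    by (cases q) (auto simp: in_triangle_def T_SW_def T_NE_def shift_eq_iff shift_eq_iff')
  then show "conj_by U (S_X L p) = xq L (star_X L (shift L (1, 1) p))"
    using assms by (auto simp: S_X_def G_X xq_mult conj_U_xq intro!: xq_cong)
  have "push_Z L (\<lambda>q. in_triangle (T_SE L p) q \<noteq> in_triangle (T_NW L p) q) q =
      face_Z L (shift L (0, 1) p) q" if "q \<in> qubits L" for q
    using that assms
    by (cases q) (auto simp: in_triangle_def site_parity_def T_SE_def T_NW_def shift_eq_iff shift_eq_iff')
  then show "conj_by U (S_Z L p) = zq L (face_Z L (shift L (0, 1) p))"
    using assms by (auto simp: S_Z_def G_Z zq_mult conj_U_zq intro!: zq_cong)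
qed

text \<open>The south-west or south-east factor occurs twice on the right and squares to the
  identity.\<close>

lemma G_mult_stabilizer:
  assumes "p \<in> sites L"
  shows "G L (T_NE L p) = X_bar L p * S_X L p" "G L (T_NW L p) = Z_bar L p * S_Z L p"
  using assms
  by (auto simp: X_bar_def S_X_def Z_bar_def S_Z_def G_X G_Z xq_mult zq_mult
      intro!: xq_cong zq_cong)

lemma conj_U_hamiltonian:
  "conj_by U (hamiltonian L) =
    - mat_sum (2 ^ (3 * L\<^sup>2))
        (\<lambda>p. J_X L p + J_X L p * conj_by U (S_X L p) + J_Z L p + J_Z L p * conj_by U (S_Z L p))
        (sites L)"
proof -
  let ?N = "2 ^ (3 * L\<^sup>2)"
  let ?S = "\<lambda>T. mat_sum ?N (\<lambda>p. conj_by U (G L (T L p))) (sites L)"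
  have G: "G L T \<in> carrier_mat ?N ?N" if "T \<in> triangles L" for T
    using that by (auto simp: triangles_eq G_X G_Z)
  have c: "conj_by U (G L (T_SW L p)) \<in> carrier_mat ?N ?N"
    "conj_by U (G L (T_NE L p)) \<in> carrier_mat ?N ?N"
    "conj_by U (G L (T_SE L p)) \<in> carrier_mat ?N ?N"
    "conj_by U (G L (T_NW L p)) \<in> carrier_mat ?N ?N" if "p \<in> sites L" for p
    using that G unitary_U by (auto simp: triangles_eq)
  have "conj_by U (mat_sum ?N (G L) (triangles L)) =
      mat_sum ?N (\<lambda>T. conj_by U (G L T)) (triangles L)"
    by (rule conj_by_mat_sum[OF unitary_U]) (auto simp: G, simp add: triangles_eq)
  also have "\<dots> = mat_sum ?N (\<lambda>T. conj_by U (G L T)) (T_SW L ` sites L \<union> T_NE L ` sites L) +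
      mat_sum ?N (\<lambda>T. conj_by U (G L T)) (T_SE L ` sites L \<union> T_NW L ` sites L)"
    unfolding triangles_eq using triangle_images_disjoint(1,2)
    by (intro mat_sum_union_disjoint) auto
  also have "\<dots> = (?S T_SW + ?S T_NE) + (?S T_SE + ?S T_NW)"
    by (simp add: mat_sum_union_disjoint triangle_images_disjoint mat_sum_reindex inj_triangles)
  also have "\<dots> = mat_sum ?N (\<lambda>p. (conj_by U (G L (T_SW L p)) + conj_by U (G L (T_NE L p))) +
      (conj_by U (G L (T_SE L p)) + conj_by U (G L (T_NW L p)))) (sites L)"
    by (simp add: mat_sum_add c)
  also have "\<dots> = mat_sum ?N (\<lambda>p. J_X L p + J_X L p * conj_by U (S_X L p) + J_Z L p +
      J_Z L p * conj_by U (S_Z L p)) (sites L)"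
  proof (rule mat_sum_cong)
    fix p assume p: "p \<in> sites L"
    have carr: "X_bar L p \<in> carrier_mat ?N ?N" "S_X L p \<in> carrier_mat ?N ?N"
      "Z_bar L p \<in> carrier_mat ?N ?N" "S_Z L p \<in> carrier_mat ?N ?N"
      using G_X[OF p] G_Z[OF p]
      by (simp_all add: X_bar_def S_X_def Z_bar_def S_Z_def xq_mult zq_mult)
    have 1: "conj_by U (G L (T_NE L p)) = J_X L p * conj_by U (S_X L p)"
      "conj_by U (G L (T_NW L p)) = J_Z L p * conj_by U (S_Z L p)"
      by (simp_all only: G_mult_stabilizer[OF p] conj_by_mult[OF unitary_U carr(1,2)]
          conj_by_mult[OF unitary_U carr(3,4)] conj_U_bar[OF p])
    have 2: "conj_by U (G L (T_SW L p)) = J_X L p" "conj_by U (G L (T_SE L p)) = J_Z L p"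
      using conj_U_bar[OF p] by (simp_all add: X_bar_def Z_bar_def)
    show "(conj_by U (G L (T_SW L p)) + conj_by U (G L (T_NE L p))) +
      (conj_by U (G L (T_SE L p)) + conj_by U (G L (T_NW L p))) =
      J_X L p + J_X L p * conj_by U (S_X L p) + J_Z L p + J_Z L p * conj_by U (S_Z L p)"
      using c[OF p] unfolding 1 2 by (simp add: assoc_add_mat[of _ ?N ?N])
  qed
  finally show ?thesis
    unfolding hamiltonian_def using conj_by_uminus[OF unitary_U] by simp
qed

end

section \<open>Ground states of frustration-free Hamiltonians\<close>

definition sqnorm :: "complex vec \<Rightarrow> real" where
  "sqnorm v = (\<Sum>i<dim_vec v. (cmod (v $ i))\<^sup>2)"

lemma cscalar_prod_eq_sum:
  "w \<in> carrier_vec N \<Longrightarrow> v \<bullet>c w = (\<Sum>i<N. v $ i * cnj (w $ i))" for v w :: "complex vec"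
  by (auto simp: scalar_prod_def atLeast0LessThan)

lemma cscalar_prod_self: "v \<bullet>c v = complex_of_real (sqnorm v)"
  by (simp add: cscalar_prod_eq_sum[of _ "dim_vec v"] carrier_vec_dim_vec sqnorm_def
      complex_norm_square[symmetric])

lemma state_iff_sqnorm: "state N \<psi> \<longleftrightarrow> \<psi> \<in> carrier_vec N \<and> sqnorm \<psi> = 1"
  by (auto simp: state_def cscalar_prod_self)

lemma sqnorm_nonneg: "sqnorm v \<ge> 0"
  by (auto simp: sqnorm_def intro: sum_nonneg)

lemma sqnorm_eq_0: "v \<in> carrier_vec N \<Longrightarrow> sqnorm v = 0 \<longleftrightarrow> v = 0\<^sub>v N"
  unfolding sqnorm_def by (subst sum_nonneg_eq_0_iff) auto

lemma sqnorm_smult: "sqnorm (a \<cdot>\<^sub>v v) = (cmod a)\<^sup>2 * sqnorm v"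
  by (simp add: sqnorm_def sum_distrib_left norm_mult power_mult_distrib)

lemma ex_state_smult:
  assumes "v \<in> carrier_vec N" "v \<noteq> 0\<^sub>v N"
  shows "\<exists>a. a \<noteq> 0 \<and> state N (a \<cdot>\<^sub>v v)"
proof (intro exI conjI)
  let ?a = "complex_of_real (1 / sqrt (sqnorm v))"
  have "sqnorm v > 0" using assms sqnorm_nonneg[of v] sqnorm_eq_0[of v N] by linarith
  then show "?a \<noteq> 0" "state N (?a \<cdot>\<^sub>v v)"
    using assms by (auto simp: state_iff_sqnorm sqnorm_smult norm_divide power_divide)
qed

lemma state_ne_0:
  assumes "state N \<psi>"
  shows "\<psi> \<noteq> 0\<^sub>v N"
proof
  assume "\<psi> = 0\<^sub>v N"
  then have "sqnorm \<psi> = 0" by (simp add: sqnorm_def)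
  then show False using assms by (simp add: state_iff_sqnorm)
qed

lemma sqnorm_diff_smult:
  assumes "x \<in> carrier_vec N" "y \<in> carrier_vec N"
  shows "sqnorm (x - complex_of_real c \<cdot>\<^sub>v y) = sqnorm x + c\<^sup>2 * sqnorm y - 2 * c * Re (x \<bullet>c y)"
proof -
  have "(cmod (a - complex_of_real c * b))\<^sup>2 = (cmod a)\<^sup>2 + c\<^sup>2 * (cmod b)\<^sup>2 - 2 * c * Re (a * cnj b)" for a b
    unfolding cmod_power2 by (simp add: power2_eq_square algebra_simps)
  then have "sqnorm (x - complex_of_real c \<cdot>\<^sub>v y) =
      (\<Sum>i<N. (cmod (x $ i))\<^sup>2 + c\<^sup>2 * (cmod (y $ i))\<^sup>2 - 2 * c * Re (x $ i * cnj (y $ i)))"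
    using assms unfolding sqnorm_def by (intro sum.cong) auto
  also have "\<dots> = sqnorm x + c\<^sup>2 * sqnorm y - 2 * c * Re (x \<bullet>c y)"
    using assms
    by (simp add: cscalar_prod_eq_sum[of y N] sqnorm_def sum.distrib sum_subtractf sum_distrib_left
        distrib_left)
  finally show ?thesis .
qed

text \<open>Expanding the nonnegative squared norm of \<open>x\<close> minus \<open>c\<close> times
  \<open>y\<close> gives the Cauchy-Schwarz bound for a unit vector \<open>y\<close>, and equality
  makes this difference vanish. The tight case is thus available as a vector identity.\<close>

lemma overlap_le:
  assumes "c > 0" "x \<in> carrier_vec N" "state N y" "sqnorm x \<le> c\<^sup>2"
  shows "Re (x \<bullet>c y) \<le> c"
    and "Re (x \<bullet>c y) = c \<Longrightarrow> x = complex_of_real c \<cdot>\<^sub>v y"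
proof -
  have y: "y \<in> carrier_vec N" "sqnorm y = 1" using assms(3) by (auto simp: state_iff_sqnorm)
  have e: "sqnorm (x - complex_of_real c \<cdot>\<^sub>v y) = sqnorm x + c\<^sup>2 - 2 * c * Re (x \<bullet>c y)"
    using sqnorm_diff_smult[OF assms(2) y(1)] y(2) by simp
  with sqnorm_nonneg[of "x - complex_of_real c \<cdot>\<^sub>v y"] assms(4)
  have "2 * c * Re (x \<bullet>c y) \<le> 2 * c * c" by (simp add: power2_eq_square)
  then show "Re (x \<bullet>c y) \<le> c" using assms(1) by simp
  assume "Re (x \<bullet>c y) = c"
  with e assms(4) sqnorm_nonneg[of "x - complex_of_real c \<cdot>\<^sub>v y"]
  have "sqnorm (x - complex_of_real c \<cdot>\<^sub>v y) = 0" by (simp add: power2_eq_square)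
  then have d: "x - complex_of_real c \<cdot>\<^sub>v y = 0\<^sub>v N"
    using assms(2) y(1) sqnorm_eq_0[of "x - complex_of_real c \<cdot>\<^sub>v y" N] by simp
  show "x = complex_of_real c \<cdot>\<^sub>v y"
  proof (rule eq_vecI)
    fix i assume "i < dim_vec (complex_of_real c \<cdot>\<^sub>v y)"
    then have "i < N" using y by simp
    then have "(x - complex_of_real c \<cdot>\<^sub>v y) $ i = 0" using d by simp
    then show "x $ i = (complex_of_real c \<cdot>\<^sub>v y) $ i"
      using \<open>i < N\<close> assms(2) y(1) by auto
  qed (use assms(2) y(1) in simp)
qed

text \<open>With \<open>x\<close> the image of \<open>y\<close> under a norm-preserving operator,
  expectation 1 forces a fixed vector.\<close>

lemma isometry_overlap:
  assumes "x \<in> carrier_vec N" "state N y" "sqnorm x = 1"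
  shows "Re (x \<bullet>c y) \<le> 1" and "Re (x \<bullet>c y) = 1 \<Longrightarrow> x = y"
  using overlap_le[of 1 x N y] assms by auto

lemma cscalar_prod_add_left:
  "v \<in> carrier_vec N \<Longrightarrow> w \<in> carrier_vec N \<Longrightarrow> u \<in> carrier_vec N \<Longrightarrow>
    (v + w) \<bullet>c u = v \<bullet>c u + w \<bullet>c u" for v w u :: "complex vec"
  by (simp add: add_scalar_prod_distrib[of _ N])

lemma expectation_mat_sum:
  assumes "finite I" "\<And>i. i \<in> I \<Longrightarrow> K i \<in> carrier_mat N N" "\<phi> \<in> carrier_vec N"
  shows "(mat_sum N K I *\<^sub>v \<phi>) \<bullet>c \<phi> = (\<Sum>i\<in>I. (K i *\<^sub>v \<phi>) \<bullet>c \<phi>)"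
  using assms(1,2)
proof (induction I)
  case empty
  have "mat_sum N K {} *\<^sub>v \<phi> = 0\<^sub>v N"
    unfolding mat_sum_empty using assms(3) by (intro eq_vecI) auto
  then show ?case using assms(3) by simp
next
  case (insert i I)
  then have "mat_sum N K (insert i I) *\<^sub>v \<phi> = K i *\<^sub>v \<phi> + mat_sum N K I *\<^sub>v \<phi>"
    using assms(3) by (simp add: mat_sum_insert add_mult_distrib_mat_vec[of _ N N])
  then show ?case
    using insert assms(3) by (simp add: cscalar_prod_add_left[of _ N] mult_mat_vec_carrier[of _ N N])
qed

lemma mat_sum_eigen:
  assumes "finite I" "\<And>i. i \<in> I \<Longrightarrow> K i \<in> carrier_mat N N" "\<phi> \<in> carrier_vec N"
    "\<And>i. i \<in> I \<Longrightarrow> K i *\<^sub>v \<phi> = c \<cdot>\<^sub>v \<phi>"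
  shows "mat_sum N K I *\<^sub>v \<phi> = (of_nat (card I) * c) \<cdot>\<^sub>v \<phi>"
  using assms(1,2,4)
proof (induction I)
  case empty
  show ?case
    unfolding mat_sum_empty using assms(3) by (intro eq_vecI) auto
next
  case (insert i I)
  then have "mat_sum N K (insert i I) *\<^sub>v \<phi> = K i *\<^sub>v \<phi> + mat_sum N K I *\<^sub>v \<phi>"
    using assms(3) by (simp add: mat_sum_insert add_mult_distrib_mat_vec[of _ N N])
  then show ?case
    using insert assms(3) by (simp add: add_smult_distrib_vec[symmetric] algebra_simps)
qed

text \<open>An eigenvalue is minus a sum of local expectations, hence at least
  \<open>- (card I * c)\<close> in its real part. The common maximizer from \<open>ex\<close> makes
  this bound an eigenvalue, so the energy of a ground state cannot exceed it, and then no single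
  term may fall short of \<open>c\<close>.\<close>

lemma frustration_free_ground_state:
  fixes K :: "'i \<Rightarrow> complex mat"
  assumes fin: "finite I" and K: "\<And>i. i \<in> I \<Longrightarrow> K i \<in> carrier_mat N N"
    and le: "\<And>i \<phi>. i \<in> I \<Longrightarrow> state N \<phi> \<Longrightarrow> Re ((K i *\<^sub>v \<phi>) \<bullet>c \<phi>) \<le> c"
    and tight: "\<And>i \<phi>. i \<in> I \<Longrightarrow> state N \<phi> \<Longrightarrow> Re ((K i *\<^sub>v \<phi>) \<bullet>c \<phi>) = c \<Longrightarrow> P i \<phi>"
    and eig: "\<And>i \<phi>. i \<in> I \<Longrightarrow> state N \<phi> \<Longrightarrow> P i \<phi> \<Longrightarrow> K i *\<^sub>v \<phi> = complex_of_real c \<cdot>\<^sub>v \<phi>"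
    and ex: "\<exists>\<phi>. state N \<phi> \<and> (\<forall>i\<in>I. P i \<phi>)"
  shows "ground_state (- mat_sum N K I) \<psi> \<longleftrightarrow> state N \<psi> \<and> (\<forall>i\<in>I. P i \<psi>)"
proof -
  define H where "H = - mat_sum N K I"
  define E where "E = - (real (card I) * c)"
  have H: "H \<in> carrier_mat N N" "dim_row H = N" by (simp_all add: H_def mat_sum_def)
  have eigH: "H *\<^sub>v \<phi> = complex_of_real E \<cdot>\<^sub>v \<phi>" if \<phi>: "state N \<phi>" "\<forall>i\<in>I. P i \<phi>" for \<phi>
  proof -
    have c: "\<phi> \<in> carrier_vec N" using \<phi> by (simp add: state_def)
    have "mat_sum N K I *\<^sub>v \<phi> = (of_nat (card I) * complex_of_real c) \<cdot>\<^sub>v \<phi>"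
      using \<phi> eig K fin c by (intro mat_sum_eigen) auto
    then have "H *\<^sub>v \<phi> = - ((of_nat (card I) * complex_of_real c) \<cdot>\<^sub>v \<phi>)"
      using c by (simp add: H_def mat_sum_def)
    then show ?thesis using c by (auto simp: E_def intro!: eq_vecI)
  qed
  have energy: "Re \<mu> = - (\<Sum>i\<in>I. Re ((K i *\<^sub>v \<phi>) \<bullet>c \<phi>))"
    if \<phi>: "state N \<phi>" "H *\<^sub>v \<phi> = \<mu> \<cdot>\<^sub>v \<phi>" for \<phi> \<mu>
  proof -
    have c: "\<phi> \<in> carrier_vec N" using \<phi> by (simp add: state_def)
    have "(H *\<^sub>v \<phi>) \<bullet>c \<phi> = - ((mat_sum N K I *\<^sub>v \<phi>) \<bullet>c \<phi>)"
      using c by (simp add: H_def mat_sum_def)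
    also have "(mat_sum N K I *\<^sub>v \<phi>) \<bullet>c \<phi> = (\<Sum>i\<in>I. (K i *\<^sub>v \<phi>) \<bullet>c \<phi>)"
      by (rule expectation_mat_sum[OF fin K c])
    finally have "\<mu> * (\<phi> \<bullet>c \<phi>) = - (\<Sum>i\<in>I. (K i *\<^sub>v \<phi>) \<bullet>c \<phi>)"
      using \<phi>(2) c by simp
    then show ?thesis using \<phi>(1) by (simp add: state_def)
  qed
  have lower: "E \<le> Re \<mu>" if ev: "eigenvalue H \<mu>" for \<mu>
  proof -
    obtain v where v: "v \<in> carrier_vec N" "v \<noteq> 0\<^sub>v N" "H *\<^sub>v v = \<mu> \<cdot>\<^sub>v v"
      using ev H(2) unfolding eigenvalue_def eigenvector_def by metis
    \<comment> \<open>The bound \<open>le\<close> concerns unit vectors, so the eigenvector is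
      normalised first.\<close>
    obtain a where a: "state N (a \<cdot>\<^sub>v v)" using ex_state_smult[OF v(1,2)] by blast
    have "H *\<^sub>v (a \<cdot>\<^sub>v v) = \<mu> \<cdot>\<^sub>v (a \<cdot>\<^sub>v v)"
      using v H by (simp add: mult_mat_vec[of _ N N] smult_smult_assoc mult.commute)
    then have "Re \<mu> = - (\<Sum>i\<in>I. Re ((K i *\<^sub>v (a \<cdot>\<^sub>v v)) \<bullet>c (a \<cdot>\<^sub>v v)))"
      using energy a by blast
    moreover have "(\<Sum>i\<in>I. Re ((K i *\<^sub>v (a \<cdot>\<^sub>v v)) \<bullet>c (a \<cdot>\<^sub>v v))) \<le> real (card I) * c"
      by (rule sum_bounded_above) (use le a in auto)
    ultimately show ?thesis by (simp add: E_def)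
  qed
  show ?thesis
  proof
    assume "ground_state (- mat_sum N K I) \<psi>"
    then obtain E' where \<psi>: "state N \<psi>" and E': "H *\<^sub>v \<psi> = complex_of_real E' \<cdot>\<^sub>v \<psi>"
      "\<And>\<mu>. eigenvalue H \<mu> \<Longrightarrow> E' \<le> Re \<mu>"
      using H unfolding ground_state_def H_def by auto
    obtain \<phi> where \<phi>: "state N \<phi>" "\<forall>i\<in>I. P i \<phi>" using ex by blast
    have "eigenvalue H (complex_of_real E)"
      using eigH[OF \<phi>] state_ne_0[OF \<phi>(1)] \<phi>(1) H
      by (auto simp: eigenvalue_def eigenvector_def state_def)
    then have "E' \<le> E" using E'(2) by fastforce
    then have s: "(\<Sum>i\<in>I. Re ((K i *\<^sub>v \<psi>) \<bullet>c \<psi>)) \<ge> (\<Sum>i\<in>I. c)"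
      using energy[OF \<psi> E'(1)] by (simp add: E_def)
    have "Re ((K i *\<^sub>v \<psi>) \<bullet>c \<psi>) = c" if "i \<in> I" for i
    proof (rule ccontr)
      assume "Re ((K i *\<^sub>v \<psi>) \<bullet>c \<psi>) \<noteq> c"
      then have "(\<Sum>i\<in>I. Re ((K i *\<^sub>v \<psi>) \<bullet>c \<psi>)) < (\<Sum>i\<in>I. c)"
        using le[OF _ \<psi>] that fin by (intro sum_strict_mono_ex1) (auto simp: less_le)
      then show False using s by simp
    qed
    then show "state N \<psi> \<and> (\<forall>i\<in>I. P i \<psi>)" using tight \<psi> by blast
  next
    assume \<psi>: "state N \<psi> \<and> (\<forall>i\<in>I. P i \<psi>)"
    then show "ground_state (- mat_sum N K I) \<psi>"
      using eigH lower H unfolding ground_state_def H_def[symmetric] by auto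
  qed
qed

lemma mat_adjoint_swap:
  assumes "M \<in> carrier_mat N N" "v \<in> carrier_vec N" "w \<in> carrier_vec N"
  shows "(M *\<^sub>v v) \<bullet>c w = (v :: complex vec) \<bullet>c (mat_adjoint M *\<^sub>v w)"
proof -
  have "(M *\<^sub>v v) \<bullet>c w = (\<Sum>i<N. \<Sum>j<N. M $$ (i, j) * v $ j * cnj (w $ i))"
    using assms
    by (simp add: cscalar_prod_eq_sum[of _ N] scalar_prod_def atLeast0LessThan sum_distrib_right)
  also have "\<dots> = (\<Sum>j<N. \<Sum>i<N. M $$ (i, j) * v $ j * cnj (w $ i))"
    by (rule sum.swap)
  also have "\<dots> = v \<bullet>c (mat_adjoint M *\<^sub>v w)"
    using assms
    by (simp add: cscalar_prod_eq_sum[of _ N] mult_mat_vec_carrier[of _ N N] mat_adjoint_eq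
        scalar_prod_def atLeast0LessThan sum_distrib_left ac_simps)
  finally show ?thesis .
qed

lemma mat_adjoint_add:
  "A \<in> carrier_mat N N \<Longrightarrow> B \<in> carrier_mat N N \<Longrightarrow>
    mat_adjoint (A + B) = mat_adjoint A + mat_adjoint B" for A B :: "complex mat"
  by (rule eq_matI) (auto simp: mat_adjoint_eq)

section \<open>Norm and expectation of a single gauge term\<close>

lemma dim_strings [simp]:
  "dim_row (xstr n s) = 2 ^ n" "dim_col (xstr n s) = 2 ^ n"
  "dim_row (zstr n s) = 2 ^ n" "dim_col (zstr n s) = 2 ^ n"
  by (simp_all add: xstr_def zstr_def mono_mat_def)

lemma sqnorm_xstr:
  assumes "v \<in> carrier_vec (2 ^ n)"
  shows "sqnorm (xstr n s *\<^sub>v v) = sqnorm v"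
proof -
  have "bij_betw (\<lambda>r. r XOR bits_of n s) {..<2 ^ n} {..<2 ^ n}"
    by (rule bij_betw_byWitness[where f' = "\<lambda>r. r XOR bits_of n s"])
      (auto simp: xor_less_exp xor.assoc)
  then have "(\<Sum>r<2 ^ n. (cmod (v $ (r XOR bits_of n s)))\<^sup>2) = (\<Sum>r<2 ^ n. (cmod (v $ r))\<^sup>2)"
    by (rule sum.reindex_bij_betw)
  then show ?thesis using assms by (simp add: sqnorm_def xstr_mult_vec del: index_mult_mat_vec)
qed

lemma sqnorm_zstr:
  assumes "v \<in> carrier_vec (2 ^ n)"
  shows "sqnorm (zstr n s *\<^sub>v v) = sqnorm v"
  using assms by (simp add: sqnorm_def zstr_mult_vec norm_mult del: index_mult_mat_vec)

lemma bits_of_eq_not: "bits_of n (\<lambda>j. s j = (\<not> t j)) = bits_of n s XOR bits_of n t"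
  by (rule bit_eqI) (auto simp: bit_xor_iff)

lemma zsign_eq_not: "zsign n (\<lambda>j. s j = (\<not> t j)) c = zsign n s c * zsign n t c"
  using zsign_mult[of n s c t] by simp

lemma zsign_bits_of_commute: "zsign n s (bits_of n t) = zsign n t (bits_of n s)"
  unfolding zsign_def by (rule prod.cong) auto

text \<open>With \<open>s\<close> the ancilla qubit and \<open>a\<close>, \<open>b\<close> the
  supports of a star and a face, this is J (1 + A) + J' (1 + B) multiplied out; products of strings
  of equal type are again strings, on the symmetric difference.\<close>

definition gauge_term :: "nat \<Rightarrow> (nat \<Rightarrow> bool) \<Rightarrow> (nat \<Rightarrow> bool) \<Rightarrow> (nat \<Rightarrow> bool) \<Rightarrow> complex mat" where
  "gauge_term n s a b =
    xstr n s + xstr n (\<lambda>j. s j \<noteq> a j) + zstr n s + zstr n (\<lambda>j. s j \<noteq> b j)"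

lemma gauge_term_carrier [simp]: "gauge_term n s a b \<in> carrier_mat (2 ^ n) (2 ^ n)"
  by (auto simp: gauge_term_def)

lemma xstr_vec_carrier [simp]: "v \<in> carrier_vec (2 ^ n) \<Longrightarrow> xstr n s *\<^sub>v v \<in> carrier_vec (2 ^ n)"
  and zstr_vec_carrier [simp]: "v \<in> carrier_vec (2 ^ n) \<Longrightarrow> zstr n s *\<^sub>v v \<in> carrier_vec (2 ^ n)"
  and gauge_term_vec_carrier [simp]:
    "v \<in> carrier_vec (2 ^ n) \<Longrightarrow> gauge_term n s a b *\<^sub>v v \<in> carrier_vec (2 ^ n)"
  by (auto intro!: mult_mat_vec_carrier[of _ "2 ^ n" "2 ^ n"])

lemma gauge_term_vec:
  assumes "v \<in> carrier_vec (2 ^ n)"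
  shows "gauge_term n s a b *\<^sub>v v =
    xstr n s *\<^sub>v v + xstr n (\<lambda>j. s j \<noteq> a j) *\<^sub>v v + zstr n s *\<^sub>v v + zstr n (\<lambda>j. s j \<noteq> b j) *\<^sub>v v"
  unfolding gauge_term_def using assms
  by (simp add: add_mult_distrib_mat_vec[of _ "2 ^ n" "2 ^ n"])

lemma mat_adjoint_gauge_term: "mat_adjoint (gauge_term n s a b) = gauge_term n s a b"
  unfolding gauge_term_def by (simp add: mat_adjoint_add[of _ "2 ^ n"])

text \<open>Read as commutation signs, the assumptions say that the X and Z strings on
  \<open>s\<close> anticommute, while the three other pairs of an X string and a Z string
  commute.\<close>

context
  fixes n :: nat and s a b :: "nat \<Rightarrow> bool"
  assumes anti: "zsign n s (bits_of n s) = - 1"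
    and comm: "zsign n s (bits_of n a) = 1" "zsign n b (bits_of n s) = 1"
      "zsign n b (bits_of n a) = 1"
begin

text \<open>The anticommutator of the two gauge operators vanishes, so only the diagonal terms
  \<open>(1 + A)\<^sup>2 + (1 + B)\<^sup>2\<close> of the square survive.\<close>

lemma gauge_term_square:
  assumes v: "v \<in> carrier_vec (2 ^ n)"
  shows "gauge_term n s a b *\<^sub>v (gauge_term n s a b *\<^sub>v v) =
    4 \<cdot>\<^sub>v v + 2 \<cdot>\<^sub>v (xstr n a *\<^sub>v v) + 2 \<cdot>\<^sub>v (zstr n b *\<^sub>v v)"
proof (rule eq_vecI)
  define S where "S = bits_of n s"
  define A where "A = bits_of n a"
  have SA: "S < 2 ^ n" "A < 2 ^ n" by (simp_all add: S_def A_def)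
  have K: "(gauge_term n s a b *\<^sub>v w) $ r = w $ (r XOR S) + w $ (r XOR (S XOR A)) +
      zsign n s r * (1 + zsign n b r) * w $ r" if "w \<in> carrier_vec (2 ^ n)" "r < 2 ^ n" for w r
    using that
    by (simp add: gauge_term_vec xstr_mult_vec zstr_mult_vec bits_of_eq_not zsign_eq_not
        S_def A_def distrib_left distrib_right mult.commute mult.left_commute
        del: index_mult_mat_vec)
  fix r assume "r < dim_vec (4 \<cdot>\<^sub>v v + 2 \<cdot>\<^sub>v (xstr n a *\<^sub>v v) + 2 \<cdot>\<^sub>v (zstr n b *\<^sub>v v))"
  then have r: "r < 2 ^ n" using v by simp
  define x where "x = zsign n s r"
  define y where "y = zsign n b r"
  have xx: "x * x = 1" "y * y = 1" by (simp_all add: x_def y_def)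
  \<comment> \<open>Flipping the bits of \<open>S\<close> reverses the sign \<open>x\<close> of J'
    and keeps the sign \<open>y\<close> of B; flipping those of \<open>A\<close> changes neither.
    The terms that mix J with J' therefore cancel below.\<close>
  have sg: "zsign n s (r XOR S) = - x" "zsign n s (r XOR (S XOR A)) = - x"
    "zsign n b (r XOR S) = y" "zsign n b (r XOR (S XOR A)) = y"
    using anti comm by (simp_all add: zsign_xor S_def A_def x_def y_def)
  have i: "(r XOR S) XOR S = r" "(r XOR (S XOR A)) XOR (S XOR A) = r"
    "(r XOR S) XOR (S XOR A) = r XOR A" "(r XOR (S XOR A)) XOR S = r XOR A"
    by (auto simp: bit_eq_iff bit_xor_iff)
  have lt: "r XOR S < 2 ^ n" "r XOR (S XOR A) < 2 ^ n" using r SA by (auto intro!: xor_less_exp)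
  have "(gauge_term n s a b *\<^sub>v (gauge_term n s a b *\<^sub>v v)) $ r =
      (v $ r + v $ (r XOR A) + - x * (1 + y) * v $ (r XOR S)) +
      (v $ (r XOR A) + v $ r + - x * (1 + y) * v $ (r XOR (S XOR A))) +
      x * (1 + y) * (v $ (r XOR S) + v $ (r XOR (S XOR A)) + x * (1 + y) * v $ r)"
    using r lt v by (simp add: K i sg x_def[symmetric] y_def[symmetric] del: index_mult_mat_vec)
  also have "\<dots> = (2 + (x * x) * (1 + 2 * y + y * y)) * v $ r + 2 * v $ (r XOR A)"
    by (simp add: algebra_simps)
  also have "\<dots> = 4 * v $ r + 2 * v $ (r XOR A) + 2 * (y * v $ r)"
    unfolding xx by (simp add: algebra_simps)
  finally show "(gauge_term n s a b *\<^sub>v (gauge_term n s a b *\<^sub>v v)) $ r =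
      (4 \<cdot>\<^sub>v v + 2 \<cdot>\<^sub>v (xstr n a *\<^sub>v v) + 2 \<cdot>\<^sub>v (zstr n b *\<^sub>v v)) $ r"
    using r v by (simp add: xstr_mult_vec zstr_mult_vec A_def y_def del: index_mult_mat_vec)
qed (simp add: gauge_term_def)

lemma sqnorm_gauge_term:
  assumes "state (2 ^ n) \<phi>"
  shows "sqnorm (gauge_term n s a b *\<^sub>v \<phi>) =
    4 + 2 * Re ((xstr n a *\<^sub>v \<phi>) \<bullet>c \<phi>) + 2 * Re ((zstr n b *\<^sub>v \<phi>) \<bullet>c \<phi>)"
proof -
  let ?K = "gauge_term n s a b"
  have \<phi>: "\<phi> \<in> carrier_vec (2 ^ n)" "\<phi> \<bullet>c \<phi> = 1" using assms by (auto simp: state_def)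
  have "complex_of_real (sqnorm (?K *\<^sub>v \<phi>)) = (?K *\<^sub>v \<phi>) \<bullet>c (?K *\<^sub>v \<phi>)"
    by (simp add: cscalar_prod_self)
  also have "\<dots> = (?K *\<^sub>v (?K *\<^sub>v \<phi>)) \<bullet>c \<phi>"
    using mat_adjoint_swap[of ?K "2 ^ n" "?K *\<^sub>v \<phi>" \<phi>] \<phi> by (simp add: mat_adjoint_gauge_term)
  also have "\<dots> = 4 + 2 * ((xstr n a *\<^sub>v \<phi>) \<bullet>c \<phi>) + 2 * ((zstr n b *\<^sub>v \<phi>) \<bullet>c \<phi>)"
    using \<phi> by (simp add: gauge_term_square cscalar_prod_add_left[of _ "2 ^ n"])
  finally show ?thesis by (simp add: complex_eq_iff)
qed

lemma gauge_term_expectation: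
  assumes "state (2 ^ n) \<phi>"
  shows "Re ((gauge_term n s a b *\<^sub>v \<phi>) \<bullet>c \<phi>) \<le> 2 * sqrt 2"
    and "Re ((gauge_term n s a b *\<^sub>v \<phi>) \<bullet>c \<phi>) = 2 * sqrt 2 \<Longrightarrow>
      xstr n a *\<^sub>v \<phi> = \<phi> \<and> zstr n b *\<^sub>v \<phi> = \<phi> \<and>
      gauge_term n s a b *\<^sub>v \<phi> = complex_of_real (2 * sqrt 2) \<cdot>\<^sub>v \<phi>"
proof -
  let ?K = "gauge_term n s a b"
  have \<phi>: "\<phi> \<in> carrier_vec (2 ^ n)" "sqnorm \<phi> = 1" using assms by (auto simp: state_iff_sqnorm)
  have o: "Re ((xstr n a *\<^sub>v \<phi>) \<bullet>c \<phi>) \<le> 1" "Re ((zstr n b *\<^sub>v \<phi>) \<bullet>c \<phi>) \<le> 1"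
    using \<phi> assms by (auto intro!: isometry_overlap[of _ "2 ^ n"] simp: sqnorm_xstr sqnorm_zstr)
  have le: "sqnorm (?K *\<^sub>v \<phi>) \<le> (2 * sqrt 2)\<^sup>2"
    unfolding sqnorm_gauge_term[OF assms] using o by (simp add: power_mult_distrib)
  note ov = overlap_le[OF _ _ assms le]
  show "Re ((?K *\<^sub>v \<phi>) \<bullet>c \<phi>) \<le> 2 * sqrt 2" by (rule ov) (use \<phi> in auto)
  assume "Re ((?K *\<^sub>v \<phi>) \<bullet>c \<phi>) = 2 * sqrt 2"
  then have K: "?K *\<^sub>v \<phi> = complex_of_real (2 * sqrt 2) \<cdot>\<^sub>v \<phi>" by (intro ov) (use \<phi> in auto)
  \<comment> \<open>The squared norm 8 is 4 + 2 + 2, so neither stabilizer expectation can be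
    smaller than 1.\<close>
  then have "sqnorm (?K *\<^sub>v \<phi>) = 8" by (simp add: sqnorm_smult \<phi> norm_mult power_mult_distrib)
  then have "Re ((xstr n a *\<^sub>v \<phi>) \<bullet>c \<phi>) = 1" "Re ((zstr n b *\<^sub>v \<phi>) \<bullet>c \<phi>) = 1"
    using o unfolding sqnorm_gauge_term[OF assms] by linarith+
  then have "xstr n a *\<^sub>v \<phi> = \<phi>" "zstr n b *\<^sub>v \<phi> = \<phi>"
    using \<phi> assms by (auto intro!: isometry_overlap(2)[of _ "2 ^ n"] simp: sqnorm_xstr sqnorm_zstr)
  then show "xstr n a *\<^sub>v \<phi> = \<phi> \<and> zstr n b *\<^sub>v \<phi> = \<phi> \<and>
      ?K *\<^sub>v \<phi> = complex_of_real (2 * sqrt 2) \<cdot>\<^sub>v \<phi>" using K by blast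
qed

end

text \<open>For A = B = 1 the term collapses to 2 (J + J'), which ties its eigenvalue 2 sqrt 2 to
  the eigenvalue sqrt 2 of J + J'.\<close>

lemma gauge_term_stabilized:
  assumes v: "v \<in> carrier_vec (2 ^ n)" and "xstr n a *\<^sub>v v = v" "zstr n b *\<^sub>v v = v"
  shows "gauge_term n s a b *\<^sub>v v = 2 \<cdot>\<^sub>v (xstr n s *\<^sub>v v + zstr n s *\<^sub>v v)"
proof -
  have "xstr n (\<lambda>j. s j \<noteq> a j) *\<^sub>v v = xstr n s *\<^sub>v (xstr n a *\<^sub>v v)"
    unfolding xstr_mult[symmetric] using v by (intro assoc_mult_mat_vec[of _ "2 ^ n" "2 ^ n" _ "2 ^ n"]) auto
  moreover have "zstr n (\<lambda>j. s j \<noteq> b j) *\<^sub>v v = zstr n s *\<^sub>v (zstr n b *\<^sub>v v)"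
    unfolding zstr_mult[symmetric] using v by (intro assoc_mult_mat_vec[of _ "2 ^ n" "2 ^ n" _ "2 ^ n"]) auto
  ultimately show ?thesis
    unfolding gauge_term_vec[OF v] assms(2,3)
    by (intro eq_vecI) (use v in \<open>auto simp del: index_mult_mat_vec\<close>)
qed

section \<open>Tensor products\<close>

lemma bij_betw_take_drop:
  "bij_betw (\<lambda>i. (take_bit m i, drop_bit m i)) {..<2 ^ (m + k)} ({..<2 ^ m} \<times> {..<(2 :: nat) ^ k})"
proof (rule bij_betw_byWitness[where f' = "\<lambda>(a, b). a + b * 2 ^ m"])
  show "(\<lambda>i. (take_bit m i, drop_bit m i)) ` {..<2 ^ (m + k)} \<subseteq> {..<2 ^ m} \<times> {..<(2 :: nat) ^ k}"
    by (auto simp: drop_bit_eq_div power_add mult.commute intro!: less_mult_imp_div_less)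
  show "(\<lambda>(a, b). a + b * 2 ^ m) ` ({..<2 ^ m} \<times> {..<(2 :: nat) ^ k}) \<subseteq> {..<2 ^ (m + k)}"
  proof -
    have "a + b * 2 ^ m < 2 ^ (m + k)" if "a < 2 ^ m" "b < 2 ^ k" for a b :: nat
    proof -
      have "a + b * 2 ^ m < (b + 1) * 2 ^ m" "b + 1 \<le> 2 ^ k" using that by auto
      then have "a + b * 2 ^ m < 2 ^ k * 2 ^ m" using mult_le_mono1 order_less_le_trans by blast
      then show ?thesis by (simp add: power_add mult.commute)
    qed
    then show ?thesis by auto
  qed
qed (auto simp: take_bit_eq_mod drop_bit_eq_div mod_div_mult_eq)

lemma sum_take_drop:
  fixes f g :: "nat \<Rightarrow> 'a :: comm_semiring_0"
  shows "(\<Sum>i<2 ^ (m + k). f (take_bit m i) * g (drop_bit m i)) = (\<Sum>i<2 ^ m. f i) * (\<Sum>j<2 ^ k. g j)"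
proof -
  have "(\<Sum>i<2 ^ (m + k). f (take_bit m i) * g (drop_bit m i)) =
      (\<Sum>(a, b)\<in>{..<2 ^ m} \<times> {..<2 ^ k}. f a * g b)"
    using sum.reindex_bij_betw[OF bij_betw_take_drop, of "\<lambda>(a, b). f a * g b" m k] by simp
  then show ?thesis by (simp add: sum_product sum.cartesian_product)
qed

lemma tensor_state_carrier [simp]: "tensor_state m k \<psi> \<phi> \<in> carrier_vec (2 ^ (m + k))"
  and dim_tensor_state [simp]: "dim_vec (tensor_state m k \<psi> \<phi>) = 2 ^ (m + k)"
  and product_state_carrier [simp]: "product_state k \<chi> \<in> carrier_vec (2 ^ k)"
  and dim_product_state [simp]: "dim_vec (product_state k \<chi>) = 2 ^ k"
  by (simp_all add: tensor_state_def product_state_def)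

lemma tensor_state_index:
  "i < 2 ^ (m + k) \<Longrightarrow> tensor_state m k \<psi> \<phi> $ i = \<psi> $ take_bit m i * \<phi> $ drop_bit m i"
  by (simp add: tensor_state_def)

lemma drop_bit_less_exp: "i < 2 ^ (m + k) \<Longrightarrow> drop_bit m i < 2 ^ k" for i :: nat
  using bij_betw_take_drop[of m k] by (auto simp: bij_betw_def)

lemma sqnorm_tensor_state:
  assumes "\<psi> \<in> carrier_vec (2 ^ m)" "\<phi> \<in> carrier_vec (2 ^ k)"
  shows "sqnorm (tensor_state m k \<psi> \<phi>) = sqnorm \<psi> * sqnorm \<phi>"
proof -
  have "sqnorm (tensor_state m k \<psi> \<phi>) =
      (\<Sum>i<2 ^ (m + k). (cmod (\<psi> $ take_bit m i))\<^sup>2 * (cmod (\<phi> $ drop_bit m i))\<^sup>2)"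
    by (simp add: sqnorm_def tensor_state_index norm_mult power_mult_distrib)
  also have "\<dots> = (\<Sum>i<2 ^ m. (cmod (\<psi> $ i))\<^sup>2) * (\<Sum>j<2 ^ k. (cmod (\<phi> $ j))\<^sup>2)"
    by (rule sum_take_drop)
  finally show ?thesis using assms by (simp add: sqnorm_def)
qed

text \<open>Expanding the power chooses one of two weights for each bit. The induction splits off
  the top bit as a second tensor factor.\<close>

lemma sum_prod_bits:
  fixes w :: "bool \<Rightarrow> 'a :: comm_semiring_1"
  shows "(\<Sum>i<(2 :: nat) ^ k. \<Prod>j<k. w (bit i j)) = (w False + w True) ^ k"
proof (induction k)
  case (Suc k)
  have "(\<Sum>i<(2 :: nat) ^ Suc k. \<Prod>j<Suc k. w (bit i j)) =
      (\<Sum>i<(2 :: nat) ^ (k + 1). (\<Prod>j<k. w (bit (take_bit k i) j)) * w (bit (drop_bit k i) 0))"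
    by (simp add: bit_take_bit_iff bit_drop_bit_eq)
  also have "\<dots> = (\<Sum>i<(2 :: nat) ^ k. \<Prod>j<k. w (bit i j)) * (\<Sum>b<(2 :: nat) ^ 1. w (bit b 0))"
    by (rule sum_take_drop)
  also have "(\<Sum>b<(2 :: nat) ^ 1. w (bit b 0)) = w False + w True"
    by (simp add: numeral_2_eq_2 bit_0)
  finally show ?case using Suc.IH by (simp add: mult.commute)
qed simp

lemma sqnorm_product_state:
  assumes "\<chi> \<in> carrier_vec 2"
  shows "sqnorm (product_state k \<chi>) = sqnorm \<chi> ^ k"
proof -
  have "sqnorm (product_state k \<chi>) = (\<Sum>i<(2 :: nat) ^ k. \<Prod>j<k. (cmod (\<chi> $ of_bool (bit i j)))\<^sup>2)"
    by (simp add: sqnorm_def product_state_def prod_norm[symmetric] prod_power_distrib)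
  also have "\<dots> = ((cmod (\<chi> $ of_bool False))\<^sup>2 + (cmod (\<chi> $ of_bool True))\<^sup>2) ^ k"
    by (rule sum_prod_bits)
  also have "\<dots> = sqnorm \<chi> ^ k"
    using assms by (simp add: sqnorm_def numeral_2_eq_2)
  finally show ?thesis .
qed

lemma state_tensor_product:
  assumes "\<psi> \<in> carrier_vec (2 ^ m)" "state 2 \<chi>"
  shows "state (2 ^ (m + k)) (tensor_state m k \<psi> (product_state k \<chi>)) \<longleftrightarrow> state (2 ^ m) \<psi>"
  using assms by (simp add: state_iff_sqnorm sqnorm_tensor_state sqnorm_product_state)

section \<open>Strings supported on the first tensor factor\<close>

lemma bits_of_low:
  assumes "\<And>j. s j \<Longrightarrow> j < m"
  shows "bits_of (m + k) s = bits_of m s"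
  by (rule bit_eqI) (auto dest: assms intro: trans_less_add1)

lemma zsign_low:
  assumes "\<And>j. s j \<Longrightarrow> j < m"
  shows "zsign (m + k) s c = zsign m s (take_bit m c)"
proof -
  have "{..<m} \<subseteq> {..<m + k}" by auto
  then show ?thesis
    unfolding zsign_def
    by (intro prod.mono_neutral_cong_right) (auto simp: bit_take_bit_iff dest: assms)
qed

lemma take_bit_xor_low: "take_bit m (r XOR bits_of m s) = take_bit m r XOR bits_of m s"
  and drop_bit_xor_low: "drop_bit m (r XOR bits_of m s) = drop_bit m r"
  by (rule bit_eqI; auto simp: bit_take_bit_iff bit_drop_bit_eq bit_xor_iff)+

lemma tensor_id_xstr:
  assumes "\<And>j. s j \<Longrightarrow> j < m"
  shows "tensor_id m k (xstr m s) = xstr (m + k) s"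
proof (rule eq_matI)
  fix r c assume "r < dim_row (xstr (m + k) s)" "c < dim_col (xstr (m + k) s)"
  then have rc: "r < 2 ^ (m + k)" "c < 2 ^ (m + k)" by simp_all
  have "drop_bit m r = drop_bit m c \<and> take_bit m r = take_bit m c XOR bits_of m s \<longleftrightarrow>
      r = c XOR bits_of m s"
    by (metis take_bit_xor_low drop_bit_xor_low bits_ident)
  then show "tensor_id m k (xstr m s) $$ (r, c) = xstr (m + k) s $$ (r, c)"
    using rc by (auto simp: tensor_id_def xstr_def mono_mat_def bits_of_low[OF assms] xor_less_exp)
qed (auto simp: tensor_id_def)

lemma tensor_id_zstr:
  assumes "\<And>j. s j \<Longrightarrow> j < m"
  shows "tensor_id m k (zstr m s) = zstr (m + k) s"
proof (rule eq_matI)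
  fix r c assume "r < dim_row (zstr (m + k) s)" "c < dim_col (zstr (m + k) s)"
  then have rc: "r < 2 ^ (m + k)" "c < 2 ^ (m + k)" by simp_all
  have "drop_bit m r = drop_bit m c \<and> take_bit m r = take_bit m c \<longleftrightarrow> r = c"
    by (metis bits_ident)
  then show "tensor_id m k (zstr m s) $$ (r, c) = zstr (m + k) s $$ (r, c)"
    using rc by (auto simp: tensor_id_def zstr_def mono_mat_def zsign_low[OF assms])
qed (auto simp: tensor_id_def)

lemma xstr_tensor_state:
  assumes "\<And>j. s j \<Longrightarrow> j < m" "\<psi> \<in> carrier_vec (2 ^ m)"
  shows "xstr (m + k) s *\<^sub>v tensor_state m k \<psi> \<phi> = tensor_state m k (xstr m s *\<^sub>v \<psi>) \<phi>"
proof (rule eq_vecI)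
  fix r assume "r < dim_vec (tensor_state m k (xstr m s *\<^sub>v \<psi>) \<phi>)"
  then have r: "r < 2 ^ (m + k)" by simp
  moreover have "bits_of m s < 2 ^ (m + k)"
    using bits_of_less[of "m + k" s] by (simp add: bits_of_low[OF assms(1)])
  ultimately have "r XOR bits_of m s < 2 ^ (m + k)" by (rule xor_less_exp)
  then show "(xstr (m + k) s *\<^sub>v tensor_state m k \<psi> \<phi>) $ r =
      tensor_state m k (xstr m s *\<^sub>v \<psi>) \<phi> $ r"
    using r assms(2)
    by (simp add: xstr_mult_vec tensor_state_index bits_of_low[OF assms(1)] take_bit_xor_low
        drop_bit_xor_low del: index_mult_mat_vec take_bit_xor drop_bit_xor)
qed simp

lemma zstr_tensor_state:
  assumes "\<And>j. s j \<Longrightarrow> j < m" "\<psi> \<in> carrier_vec (2 ^ m)"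
  shows "zstr (m + k) s *\<^sub>v tensor_state m k \<psi> \<phi> = tensor_state m k (zstr m s *\<^sub>v \<psi>) \<phi>"
  by (rule eq_vecI)
    (use assms(2) in \<open>simp_all add: zstr_mult_vec tensor_state_index zsign_low[OF assms(1)]
        del: index_mult_mat_vec\<close>)

lemma product_state_0: "product_state k \<chi> $ 0 = (\<chi> $ 0) ^ k"
  by (simp add: product_state_def)

text \<open>Indices below \<open>2 ^ m\<close> have high part 0, so there the amplitudes of the
  first factor appear multiplied by the nonzero constant \<open>\<phi> $ 0\<close>.\<close>

lemma tensor_state_cancel:
  assumes "tensor_state m k \<psi> \<phi> = tensor_state m k \<psi>' \<phi>" "\<phi> $ 0 \<noteq> 0"
    "\<psi> \<in> carrier_vec (2 ^ m)" "\<psi>' \<in> carrier_vec (2 ^ m)"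
  shows "\<psi> = \<psi>'"
proof (rule eq_vecI)
  fix i assume "i < dim_vec \<psi>'"
  then have i: "i < 2 ^ m" using assms(4) by simp
  then have "i < 2 ^ (m + k)" by (rule order_less_le_trans) simp
  moreover have "take_bit m i = i" "drop_bit m i = 0"
    using i by (simp_all add: take_bit_nat_eq_self drop_bit_eq_div)
  ultimately show "\<psi> $ i = \<psi>' $ i"
    using arg_cong[OF assms(1), of "\<lambda>v. v $ i"] assms(2) by (simp add: tensor_state_index)
qed (use assms in simp)

lemma xstr_tensor_fixed_iff:
  assumes "\<And>j. s j \<Longrightarrow> j < m" "\<psi> \<in> carrier_vec (2 ^ m)" "\<phi> $ 0 \<noteq> 0"
  shows "xstr (m + k) s *\<^sub>v tensor_state m k \<psi> \<phi> = tensor_state m k \<psi> \<phi> \<longleftrightarrow> xstr m s *\<^sub>v \<psi> = \<psi>"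
proof
  assume "xstr (m + k) s *\<^sub>v tensor_state m k \<psi> \<phi> = tensor_state m k \<psi> \<phi>"
  then have "tensor_state m k (xstr m s *\<^sub>v \<psi>) \<phi> = tensor_state m k \<psi> \<phi>"
    by (simp only: xstr_tensor_state[OF assms(1,2)])
  then show "xstr m s *\<^sub>v \<psi> = \<psi>"
    by (rule tensor_state_cancel[OF _ assms(3) xstr_vec_carrier[OF assms(2)] assms(2)])
qed (simp only: xstr_tensor_state[OF assms(1,2)])

lemma zstr_tensor_fixed_iff:
  assumes "\<And>j. s j \<Longrightarrow> j < m" "\<psi> \<in> carrier_vec (2 ^ m)" "\<phi> $ 0 \<noteq> 0"
  shows "zstr (m + k) s *\<^sub>v tensor_state m k \<psi> \<phi> = tensor_state m k \<psi> \<phi> \<longleftrightarrow> zstr m s *\<^sub>v \<psi> = \<psi>"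
proof
  assume "zstr (m + k) s *\<^sub>v tensor_state m k \<psi> \<phi> = tensor_state m k \<psi> \<phi>"
  then have "tensor_state m k (zstr m s *\<^sub>v \<psi>) \<phi> = tensor_state m k \<psi> \<phi>"
    by (simp only: zstr_tensor_state[OF assms(1,2)])
  then show "zstr m s *\<^sub>v \<psi> = \<psi>"
    by (rule tensor_state_cancel[OF _ assms(3) zstr_vec_carrier[OF assms(2)] assms(2)])
qed (simp only: zstr_tensor_state[OF assms(1,2)])

section \<open>The sqrt 2 eigenvector of X + Z and its product states\<close>

lemma sqrt2_eigen:
  fixes t x y :: complex
  assumes "t * t = 2" "y = (t - 1) * x"
  shows "x + y = t * x" "x - y = t * y"
proof -
  show "x + y = t * x" unfolding assms(2) by (simp add: algebra_simps)
  have "t * y = (t * t) * x - t * x" unfolding assms(2) by (simp add: algebra_simps)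
  then show "x - y = t * y" unfolding assms(1) assms(2) by (simp add: algebra_simps)
qed

text \<open>The two rows of the eigenvalue equation are proportional because sqrt 2 squares to 2, so
  a single linear relation between the amplitudes remains.\<close>

lemma sigma_eigen_iff:
  assumes "\<chi> \<in> carrier_vec 2"
  shows "(sigma_x + sigma_z) *\<^sub>v \<chi> = complex_of_real (sqrt 2) \<cdot>\<^sub>v \<chi> \<longleftrightarrow>
    \<chi> $ 1 = (complex_of_real (sqrt 2) - 1) * \<chi> $ 0"
proof -
  let ?t = "complex_of_real (sqrt 2)"
  have t: "?t * ?t = 2" by (simp flip: of_real_mult)
  have d: "dim_row (sigma_x + sigma_z) = 2" "dim_col (sigma_x + sigma_z) = 2"
    by (simp_all add: sigma_z_def mat_of_rows_list_def)
  have i: "((sigma_x + sigma_z) *\<^sub>v \<chi>) $ 0 = \<chi> $ 0 + \<chi> $ 1"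
    "((sigma_x + sigma_z) *\<^sub>v \<chi>) $ 1 = \<chi> $ 0 - \<chi> $ 1"
    using assms
    by (auto simp: sigma_x_def sigma_z_def mat_of_rows_list_def scalar_prod_def numeral_2_eq_2)
  have "(sigma_x + sigma_z) *\<^sub>v \<chi> = ?t \<cdot>\<^sub>v \<chi> \<longleftrightarrow>
      \<chi> $ 0 + \<chi> $ 1 = ?t * \<chi> $ 0 \<and> \<chi> $ 0 - \<chi> $ 1 = ?t * \<chi> $ 1"
  proof
    assume e: "(sigma_x + sigma_z) *\<^sub>v \<chi> = ?t \<cdot>\<^sub>v \<chi>"
    show "\<chi> $ 0 + \<chi> $ 1 = ?t * \<chi> $ 0 \<and> \<chi> $ 0 - \<chi> $ 1 = ?t * \<chi> $ 1"
      using i assms unfolding e by auto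
  next
    assume e: "\<chi> $ 0 + \<chi> $ 1 = ?t * \<chi> $ 0 \<and> \<chi> $ 0 - \<chi> $ 1 = ?t * \<chi> $ 1"
    show "(sigma_x + sigma_z) *\<^sub>v \<chi> = ?t \<cdot>\<^sub>v \<chi>"
    proof (rule eq_vecI)
      fix j assume "j < dim_vec (?t \<cdot>\<^sub>v \<chi>)"
      then have "j = 0 \<or> j = 1" using assms by auto
      then show "((sigma_x + sigma_z) *\<^sub>v \<chi>) $ j = (?t \<cdot>\<^sub>v \<chi>) $ j"
        using i e assms by auto
    qed (use assms d in simp)
  qed
  also have "\<dots> \<longleftrightarrow> \<chi> $ 1 = (?t - 1) * \<chi> $ 0"
  proof
    assume "\<chi> $ 1 = (?t - 1) * \<chi> $ 0"
    then show "\<chi> $ 0 + \<chi> $ 1 = ?t * \<chi> $ 0 \<and> \<chi> $ 0 - \<chi> $ 1 = ?t * \<chi> $ 1"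
      using sqrt2_eigen[OF t] by blast
  next
    assume "\<chi> $ 0 + \<chi> $ 1 = ?t * \<chi> $ 0 \<and> \<chi> $ 0 - \<chi> $ 1 = ?t * \<chi> $ 1"
    then have "\<chi> $ 0 + \<chi> $ 1 = ?t * \<chi> $ 0" ..
    then have "\<chi> $ 1 = ?t * \<chi> $ 0 - \<chi> $ 0" by (simp only: eq_diff_eq add.commute)
    then show "\<chi> $ 1 = (?t - 1) * \<chi> $ 0" by (simp only: left_diff_distrib mult_1)
  qed
  finally show ?thesis .
qed

text \<open>Provides the pivot: division by this amplitude later recovers the first tensor
  factor.\<close>

lemma sigma_eigenstate_ne_0:
  assumes "state 2 \<chi>" "\<chi> $ 1 = (complex_of_real (sqrt 2) - 1) * \<chi> $ 0"
  shows "\<chi> $ 0 \<noteq> 0"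
proof
  assume "\<chi> $ 0 = 0"
  with assms have "sqnorm \<chi> = 0" "sqnorm \<chi> = 1"
    by (auto simp: state_iff_sqnorm sqnorm_def numeral_2_eq_2)
  then show False by simp
qed

lemma ex_sigma_eigenstate:
  "\<exists>\<chi>. state 2 \<chi> \<and> \<chi> $ 1 = (complex_of_real (sqrt 2) - 1) * \<chi> $ 0"
proof -
  define v where "v = vec 2 (\<lambda>i. if i = 0 then 1 else complex_of_real (sqrt 2) - 1)"
  have v: "v $ 0 = 1" "v $ 1 = complex_of_real (sqrt 2) - 1" "v \<in> carrier_vec 2"
    by (simp_all add: v_def)
  then have "v \<noteq> 0\<^sub>v 2" by auto
  then obtain a where "state 2 (a \<cdot>\<^sub>v v)" using ex_state_smult[OF v(3)] by blast
  moreover have "(a \<cdot>\<^sub>v v) $ 1 = (complex_of_real (sqrt 2) - 1) * (a \<cdot>\<^sub>v v) $ 0"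
    using v by simp
  ultimately show ?thesis by blast
qed

lemma bit_xor_single: "bit (r XOR bits_of n (\<lambda>i. i = q)) j \<longleftrightarrow> bit r j \<noteq> (j = q \<and> q < n)"
  by (auto simp: bit_xor_iff)

lemma single_tensor_vec:
  assumes "\<psi> \<in> carrier_vec (2 ^ (m + k))" "q < k"
  shows "xstr (m + k) (\<lambda>i. i = m + q) *\<^sub>v \<psi> + zstr (m + k) (\<lambda>i. i = m + q) *\<^sub>v \<psi> =
      complex_of_real (sqrt 2) \<cdot>\<^sub>v \<psi> \<longleftrightarrow>
    (\<forall>r<2 ^ (m + k). \<psi> $ (r XOR bits_of (m + k) (\<lambda>i. i = m + q)) +
      (if bit r (m + q) then - 1 else 1) * \<psi> $ r = complex_of_real (sqrt 2) * \<psi> $ r)"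
    (is "?v = ?w \<longleftrightarrow> _")
proof -
  have "?v = ?w \<longleftrightarrow> (\<forall>r<2 ^ (m + k). ?v $ r = ?w $ r)"
    using assms(1) by (auto simp: vec_eq_iff)
  then show ?thesis
    using assms
    by (simp add: xstr_mult_vec zstr_mult_vec zsign_single del: index_mult_mat_vec)
qed

lemma product_state_eigen:
  assumes "\<chi> $ 1 = (complex_of_real (sqrt 2) - 1) * \<chi> $ 0" "\<psi> \<in> carrier_vec (2 ^ m)" "q < k"
  defines "\<Psi> \<equiv> tensor_state m k \<psi> (product_state k \<chi>)"
  shows "xstr (m + k) (\<lambda>i. i = m + q) *\<^sub>v \<Psi> + zstr (m + k) (\<lambda>i. i = m + q) *\<^sub>v \<Psi> =
    complex_of_real (sqrt 2) \<cdot>\<^sub>v \<Psi>"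
proof -
  let ?t = "complex_of_real (sqrt 2)"
  have "\<Psi> $ (r XOR bits_of (m + k) (\<lambda>i. i = m + q)) +
      (if bit r (m + q) then - 1 else 1) * \<Psi> $ r = ?t * \<Psi> $ r" if r: "r < 2 ^ (m + k)" for r
  proof -
    define r' where "r' = r XOR bits_of (m + k) (\<lambda>i. i = m + q)"
    have r': "r' < 2 ^ (m + k)" using r by (simp add: r'_def xor_less_exp)
    have take: "take_bit m r' = take_bit m r"
      by (rule bit_eqI) (auto simp: r'_def bit_take_bit_iff bit_xor_single simp del: take_bit_xor)
    have bit_r': "bit r' (m + j) \<longleftrightarrow> bit r (m + j) \<noteq> (j = q)" for j
      using assms(3) by (auto simp: r'_def bit_xor_single)
    \<comment> \<open>The amplitudes at \<open>r\<close> and \<open>r'\<close> share the factors of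
      all other ancillas. What remains is the eigenvalue equation of one qubit.\<close>
    define R where "R = (\<Prod>j\<in>{..<k} - {q}. \<chi> $ of_bool (bit r (m + j)))"
    have R: "product_state k \<chi> $ drop_bit m s = \<chi> $ of_bool (bit s (m + q)) *
        (\<Prod>j\<in>{..<k} - {q}. \<chi> $ of_bool (bit s (m + j)))" if "s < 2 ^ (m + k)" for s
      using drop_bit_less_exp[OF that] assms(3)
      by (simp add: product_state_def bit_drop_bit_eq prod.remove[of _ q])
    have "(\<Prod>j\<in>{..<k} - {q}. \<chi> $ of_bool (bit r' (m + j))) = R"
      unfolding R_def by (rule prod.cong) (auto simp: bit_r')
    then have *: "\<Psi> $ r' = \<psi> $ take_bit m r * (\<chi> $ of_bool (\<not> bit r (m + q)) * R)"
      "\<Psi> $ r = \<psi> $ take_bit m r * (\<chi> $ of_bool (bit r (m + q)) * R)"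
      using r r' by (simp_all add: \<Psi>_def tensor_state_index R take bit_r' R_def[symmetric])
    have "?t * ?t = 2" by (simp flip: of_real_mult)
    note e = sqrt2_eigen[OF this assms(1)]
    have "P * (\<chi> $ 0 * R) - P * (\<chi> $ Suc 0 * R) = ?t * (P * (\<chi> $ Suc 0 * R))"
      "P * (\<chi> $ Suc 0 * R) + P * (\<chi> $ 0 * R) = ?t * (P * (\<chi> $ 0 * R))" for P
    proof -
      have "P * (\<chi> $ 0 * R) - P * (\<chi> $ Suc 0 * R) = P * (\<chi> $ 0 - \<chi> $ Suc 0) * R"
        by (simp add: algebra_simps)
      then show "P * (\<chi> $ 0 * R) - P * (\<chi> $ Suc 0 * R) = ?t * (P * (\<chi> $ Suc 0 * R))"
        using e(2) by (simp add: ac_simps)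
      have "P * (\<chi> $ Suc 0 * R) + P * (\<chi> $ 0 * R) = P * (\<chi> $ 0 + \<chi> $ Suc 0) * R"
        by (simp add: algebra_simps)
      then show "P * (\<chi> $ Suc 0 * R) + P * (\<chi> $ 0 * R) = ?t * (P * (\<chi> $ 0 * R))"
        using e(1) by (simp add: ac_simps)
    qed
    then show ?thesis
      unfolding r'_def[symmetric] * by (cases "bit r (m + q)") simp_all
  qed
  then show ?thesis
    using assms(3) by (subst single_tensor_vec) (auto simp: \<Psi>_def)
qed

text \<open>At an index whose ancilla bit is clear, the eigenvalue equation determines the amplitude
  with that bit set, by the ratio \<open>sqrt 2 - 1\<close> regardless of all other bits. Switching
  on ancilla bits one at a time recovers every amplitude from those with all ancillas 0. Dividing by
  \<open>(\<chi> $ 0) ^ k\<close> removes the weight that the product state gives to this all-zero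
  pattern.\<close>

lemma eigen_imp_tensor_product:
  assumes \<chi>: "\<chi> $ 1 = (complex_of_real (sqrt 2) - 1) * \<chi> $ 0" "\<chi> $ 0 \<noteq> 0"
    and \<Psi>: "\<Psi> \<in> carrier_vec (2 ^ (m + k))"
    and eig: "\<And>q. q < k \<Longrightarrow> xstr (m + k) (\<lambda>i. i = m + q) *\<^sub>v \<Psi> + zstr (m + k) (\<lambda>i. i = m + q) *\<^sub>v \<Psi> =
      complex_of_real (sqrt 2) \<cdot>\<^sub>v \<Psi>"
  shows "\<Psi> = tensor_state m k (vec (2 ^ m) (\<lambda>i. \<Psi> $ i / (\<chi> $ 0) ^ k)) (product_state k \<chi>)"
proof -
  let ?t = "complex_of_real (sqrt 2)"
  have step: "\<Psi> $ (r XOR bits_of (m + k) (\<lambda>i. i = m + q)) = (?t - 1) * \<Psi> $ r"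
    if "r < 2 ^ (m + k)" "q < k" "\<not> bit r (m + q)" for r q
    using eig[OF that(2)] that unfolding single_tensor_vec[OF \<Psi> that(2)]
    by (auto simp: algebra_simps)
  \<comment> \<open>The powers of \<open>\<chi> $ 0\<close> are kept on the left, so that the
    induction involves no division.\<close>
  have ind: "\<Psi> $ take_bit (m + l) r * (\<chi> $ 0) ^ l =
      \<Psi> $ take_bit m r * (\<Prod>j<l. \<chi> $ of_bool (bit r (m + j)))"
    if r: "r < 2 ^ (m + k)" and l: "l \<le> k" for r l
    using l
  proof (induction l)
    case (Suc l)
    define s where "s = take_bit (m + l) r"
    have IH: "\<Psi> $ s * (\<chi> $ 0) ^ l = \<Psi> $ take_bit m r * (\<Prod>j<l. \<chi> $ of_bool (bit r (m + j)))"
      using Suc by (simp add: s_def)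
    have s: "s < 2 ^ (m + k)" "\<not> bit s (m + l)"
      using r unfolding s_def nat_less_exp_iff_bit by (auto simp: bit_take_bit_iff)
    show ?case
    proof (cases "bit r (m + l)")
      case True
      have "take_bit (m + Suc l) r = s XOR bits_of (m + k) (\<lambda>i. i = m + l)"
        using Suc.prems True
        by (intro bit_eqI) (auto simp: s_def bit_take_bit_iff bit_xor_single less_Suc_eq)
      then have "\<Psi> $ take_bit (m + Suc l) r * (\<chi> $ 0) ^ Suc l =
          (\<Psi> $ s * (\<chi> $ 0) ^ l) * \<chi> $ 1"
        using step[of s l] s Suc.prems \<chi>(1) by simp
      then show ?thesis unfolding IH using True by simp
    next
      case False
      have "take_bit (m + Suc l) r = s"
        using False by (intro bit_eqI) (auto simp: s_def bit_take_bit_iff less_Suc_eq)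
      then have "\<Psi> $ take_bit (m + Suc l) r * (\<chi> $ 0) ^ Suc l =
          (\<Psi> $ s * (\<chi> $ 0) ^ l) * \<chi> $ 0" by simp
      then show ?thesis unfolding IH using False by simp
    qed
  qed simp
  show ?thesis
  proof (rule eq_vecI)
    fix r assume "r < dim_vec (tensor_state m k (vec (2 ^ m) (\<lambda>i. \<Psi> $ i / (\<chi> $ 0) ^ k)) (product_state k \<chi>))"
    then have r: "r < 2 ^ (m + k)" by simp
    then have "take_bit (m + k) r = r" by (simp add: take_bit_nat_eq_self)
    then show "\<Psi> $ r =
        tensor_state m k (vec (2 ^ m) (\<lambda>i. \<Psi> $ i / (\<chi> $ 0) ^ k)) (product_state k \<chi>) $ r"
      using ind[OF r order_refl] r drop_bit_less_exp[OF r] \<chi>(2)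
      by (simp add: tensor_state_index product_state_def bit_drop_bit_eq field_simps)
  qed (use \<Psi> in simp)
qed

section \<open>The decoupled toric code\<close>

text \<open>In a transformed star the two vertices differ by (1, 0) and the two vertical edges by
  (1, -1); these differences become the lattice vectors. The vertical edge attached to
  \<open>s\<close> is the one that reaches \<open>s\<close> from below, which aligns both pairs at
  the same site of the tilted lattice.\<close>

fun edge_qubit :: "nat \<Rightarrow> toric_edge \<Rightarrow> qubit" where
  "edge_qubit L (Edge1 s) = Vertex s"
| "edge_qubit L (Edge2 s) = VEdge (shift L (0, - 1) s)"

lemma qubit_count: "3 * L\<^sup>2 = 2 * L\<^sup>2 + L\<^sup>2" for L :: nat
  by simp

lemma at_idx_low:
  assumes "\<And>u. \<not> s (HEdge u)" "at_idx L s j"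
  shows "j < 2 * L\<^sup>2"
proof -
  obtain q where "q \<in> qubits L" "idx L q = j" "s q" using assms(2) by (auto simp: at_idx_def)
  then show ?thesis using idx_less_top[of q L] assms(1) by auto
qed

lemma zsign_at_idx_single:
  "q \<in> qubits L \<Longrightarrow> idx L q < n \<Longrightarrow>
    zsign n (at_idx L (\<lambda>r. r = q)) (bits_of n (at_idx L s)) = (if s q then - 1 else 1)"
  by (simp add: at_idx_single zsign_single)

lemma smult_vec_cancel:
  fixes u v :: "complex vec"
  assumes "a \<noteq> 0" "a \<cdot>\<^sub>v u = (a * b) \<cdot>\<^sub>v v"
  shows "u = b \<cdot>\<^sub>v v"
proof -
  have "(1 / a) \<cdot>\<^sub>v (a \<cdot>\<^sub>v u) = (1 / a) \<cdot>\<^sub>v ((a * b) \<cdot>\<^sub>v v)" using assms(2) by simp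
  then show ?thesis using assms(1) by (simp add: smult_smult_assoc)
qed

section \<open>Stars, faces and the ground states of the toric code\<close>

context torus
begin

lemma bij_edge_qubit: "bij_betw (edge_qubit L) (toric_edges L) (top_qubits L)"
  unfolding bij_betw_def
proof
  show "inj_on (edge_qubit L) (toric_edges L)"
    by (rule inj_onI) (auto simp: toric_edges_def shift_eq_iff)
  have "(\<lambda>s. VEdge (shift L (0, - 1) s)) ` sites L = VEdge ` (shift L (0, - 1) ` sites L)"
    by (simp only: image_image)
  then show "edge_qubit L ` toric_edges L = top_qubits L"
    by (simp add: toric_edges_def top_qubits_def image_Un image_image)
qed

lemma toric_string:
  assumes "edge_qubit L e \<in> top_qubits L"
  shows "toric_X L (edge_qubit L) e = xstr (2 * L\<^sup>2) (at_idx L (\<lambda>q. q = edge_qubit L e))"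
    and "toric_Z L (edge_qubit L) e = zstr (2 * L\<^sup>2) (at_idx L (\<lambda>q. q = edge_qubit L e))"
proof -
  have "edge_qubit L e \<in> qubits L" "idx L (edge_qubit L e) < 2 * L\<^sup>2"
    using assms by (auto simp: top_qubits_def idx_less_top dest: site_index_less)
  then show "toric_X L (edge_qubit L) e = xstr (2 * L\<^sup>2) (at_idx L (\<lambda>q. q = edge_qubit L e))"
    and "toric_Z L (edge_qubit L) e = zstr (2 * L\<^sup>2) (at_idx L (\<lambda>q. q = edge_qubit L e))"
    by (simp_all add: toric_X_def toric_Z_def on_qubit_sigma_x on_qubit_sigma_z at_idx_single)
qed

lemma edge_in_top:
  "s \<in> sites L \<Longrightarrow> edge_qubit L (Edge1 s) \<in> top_qubits L"
  "s \<in> sites L \<Longrightarrow> edge_qubit L (Edge2 s) \<in> top_qubits L"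
  by (auto simp: top_qubits_def)

abbreviation "star \<equiv> star_op L (1, 0) (1, - 1) (edge_qubit L)"
abbreviation "face \<equiv> face_op L (1, 0) (1, - 1) (edge_qubit L)"
abbreviation "toricH \<equiv> toric_hamiltonian L (1, 0) (1, - 1) (edge_qubit L)"

lemma star_eq:
  assumes "v \<in> sites L"
  shows "star v = xstr (2 * L\<^sup>2) (at_idx L (star_X L v))"
proof -
  have "star v = xstr (2 * L\<^sup>2) (at_idx L (\<lambda>q. (((q = Vertex v) \<noteq> (q = Vertex (shift L (- 1, 0) v))) \<noteq>
      (q = VEdge (shift L (0, - 1) v))) \<noteq> (q = VEdge (shift L (- 1, 0) v))))"
    using assms
    by (simp only: star_op_def toric_string edge_in_top shift_in_sites pos xstr_mult at_idx_xor
        fst_conv snd_conv minus_minus) simp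
  also have "\<dots> = xstr (2 * L\<^sup>2) (at_idx L (star_X L v))"
  proof (rule arg_cong[where f = "xstr _"], rule at_idx_cong)
    fix q
    show "((((q = Vertex v) \<noteq> (q = Vertex (shift L (- 1, 0) v))) \<noteq>
      (q = VEdge (shift L (0, - 1) v))) \<noteq> (q = VEdge (shift L (- 1, 0) v))) = star_X L v q"
      by (cases q) auto
  qed
  finally show ?thesis .
qed

lemma face_eq:
  assumes "f \<in> sites L"
  shows "face f = zstr (2 * L\<^sup>2) (at_idx L (face_Z L f))"
proof -
  have "face f = zstr (2 * L\<^sup>2) (at_idx L (\<lambda>q. (((q = Vertex f) \<noteq> (q = Vertex (shift L (1, - 1) f))) \<noteq>
      (q = VEdge (shift L (0, - 1) f))) \<noteq> (q = VEdge (shift L (1, - 1) f))))"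
    using assms
    by (simp only: face_op_def toric_string edge_in_top shift_in_sites pos zstr_mult at_idx_xor
        fst_conv snd_conv minus_minus) simp
  also have "\<dots> = zstr (2 * L\<^sup>2) (at_idx L (face_Z L f))"
  proof (rule arg_cong[where f = "zstr _"], rule at_idx_cong)
    fix q
    show "((((q = Vertex f) \<noteq> (q = Vertex (shift L (1, - 1) f))) \<noteq>
      (q = VEdge (shift L (0, - 1) f))) \<noteq> (q = VEdge (shift L (1, - 1) f))) = face_Z L f q"
      by (cases q) auto
  qed
  finally show ?thesis .
qed

lemma star_low: "at_idx L (star_X L v) j \<Longrightarrow> j < 2 * L\<^sup>2"
  and face_low: "at_idx L (face_Z L f) j \<Longrightarrow> j < 2 * L\<^sup>2"
  by (erule at_idx_low[rotated], simp)+

lemma conj_U_tensor_id: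
  assumes "p \<in> sites L"
  shows "conj_by U (S_X L p) = tensor_id (2 * L\<^sup>2) (L\<^sup>2) (star (shift L (1, 1) p))"
    and "conj_by U (S_Z L p) = tensor_id (2 * L\<^sup>2) (L\<^sup>2) (face (shift L (0, 1) p))"
  using assms star_low face_low
  by (simp_all add: conj_U_stabilizers star_eq face_eq tensor_id_xstr tensor_id_zstr xq_def zq_def)

text \<open>The sign factors over the four qubits of the face. A factor can be negative only if
  \<open>f\<close> is \<open>v\<close> displaced by (0, 0), (-1, 0), (-1, 1) or (-2, 1), and each of
  these four conditions occurs in exactly two factors, so the signs cancel in pairs.\<close>

lemma star_face_commute:
  assumes "v \<in> sites L" "f \<in> sites L" "n \<ge> 2 * L\<^sup>2"
  shows "zsign n (at_idx L (face_Z L f)) (bits_of n (at_idx L (star_X L v))) = 1"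
proof -
  define sg where "sg q = zsign n (at_idx L (\<lambda>r. r = q)) (bits_of n (at_idx L (star_X L v)))" for q
  have sg: "sg q = (if star_X L v q then - 1 else 1)" if "q \<in> top_qubits L" for q
  proof -
    have "q \<in> qubits L" "idx L q < n"
      using that assms(3) idx_less_top[of q L] by (auto simp: top_qubits_def)
    then show ?thesis by (simp add: sg_def zsign_at_idx_single)
  qed
  have "at_idx L (face_Z L f) = at_idx L (\<lambda>q. (((q = Vertex f) \<noteq> (q = Vertex (shift L (1, - 1) f))) \<noteq>
      (q = VEdge (shift L (0, - 1) f))) \<noteq> (q = VEdge (shift L (1, - 1) f)))"
  proof (rule at_idx_cong)
    fix q
    show "face_Z L f q = ((((q = Vertex f) \<noteq> (q = Vertex (shift L (1, - 1) f))) \<noteq>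
      (q = VEdge (shift L (0, - 1) f))) \<noteq> (q = VEdge (shift L (1, - 1) f)))"
      by (cases q) auto
  qed
  then have "zsign n (at_idx L (face_Z L f)) (bits_of n (at_idx L (star_X L v))) =
      sg (Vertex f) * sg (Vertex (shift L (1, - 1) f)) * sg (VEdge (shift L (0, - 1) f)) *
      sg (VEdge (shift L (1, - 1) f))"
    by (simp only: at_idx_xor[symmetric] zsign_mult[symmetric] sg_def)
  also have "\<dots> = 1"
    using assms(1,2) by (simp add: sg top_qubits_def shift_eq_iff shift_eq_iff')
  finally show ?thesis .
qed

lemma ex_toric_state:
  "\<exists>\<phi>. state (2 ^ (2 * L\<^sup>2)) \<phi> \<and> (\<forall>s\<in>sites L. star s *\<^sub>v \<phi> = \<phi> \<and> face s *\<^sub>v \<phi> = \<phi>)"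
proof -
  let ?m = "2 * L\<^sup>2"
  define even where "even r \<longleftrightarrow> (\<forall>f\<in>sites L. zsign ?m (at_idx L (face_Z L f)) r = 1)" for r
  define v where "v = vec (2 ^ ?m) (\<lambda>r. if even r then 1 else 0 :: complex)"
  have v: "v \<in> carrier_vec (2 ^ ?m)" by (simp add: v_def)
  \<comment> \<open>Index 0 satisfies every parity constraint, so the superposition is not the zero
    vector.\<close>
  have "v $ 0 = 1" by (simp add: v_def even_def zsign_def)
  then have "v \<noteq> 0\<^sub>v (2 ^ ?m)" by auto
  then obtain a where a: "state (2 ^ ?m) (a \<cdot>\<^sub>v v)" using ex_state_smult[OF v] by blast
  have st: "star s *\<^sub>v v = v" if s: "s \<in> sites L" for s
  proof (rule eq_vecI)
    fix r assume "r < dim_vec v"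
    then have r: "r < 2 ^ ?m" by (simp add: v_def)
    \<comment> \<open>A star meets every face in an even number of edges, so flipping its bits
      permutes the even strings.\<close>
    have "even (r XOR bits_of ?m (at_idx L (star_X L s))) = even r"
      using s by (simp add: even_def zsign_xor star_face_commute)
    then show "(star s *\<^sub>v v) $ r = v $ r"
      using r s v by (simp add: star_eq xstr_mult_vec del: index_mult_mat_vec)
        (simp add: v_def xor_less_exp)
  qed (simp add: v_def star_eq[OF s])
  have fa: "face s *\<^sub>v v = v" if s: "s \<in> sites L" for s
  proof (rule eq_vecI)
    fix r assume "r < dim_vec v"
    then have r: "r < 2 ^ ?m" by (simp add: v_def)
    then show "(face s *\<^sub>v v) $ r = v $ r"
      using s v by (simp add: face_eq zstr_mult_vec del: index_mult_mat_vec)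
        (simp add: v_def even_def)
  qed (simp add: v_def face_eq[OF s])
  have "star s *\<^sub>v (a \<cdot>\<^sub>v v) = a \<cdot>\<^sub>v v" "face s *\<^sub>v (a \<cdot>\<^sub>v v) = a \<cdot>\<^sub>v v" if "s \<in> sites L" for s
    using st[OF that] fa[OF that] v that
    by (simp_all add: star_eq face_eq mult_mat_vec[of _ "2 ^ ?m" "2 ^ ?m"])
  then show ?thesis using a by blast
qed

lemma toric_ground_state_iff:
  "ground_state toricH \<psi> \<longleftrightarrow>
    state (2 ^ (2 * L\<^sup>2)) \<psi> \<and> (\<forall>s\<in>sites L. star s *\<^sub>v \<psi> = \<psi> \<and> face s *\<^sub>v \<psi> = \<psi>)"
proof -
  let ?N = "2 ^ (2 * L\<^sup>2)"
  have c: "star s \<in> carrier_mat ?N ?N" "face s \<in> carrier_mat ?N ?N" if "s \<in> sites L" for s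
    using that by (simp_all add: star_eq face_eq)
  have split: "((star s + face s) *\<^sub>v \<phi>) = star s *\<^sub>v \<phi> + face s *\<^sub>v \<phi>"
    if "s \<in> sites L" "state ?N \<phi>" for s \<phi>
    using that c by (simp add: add_mult_distrib_mat_vec[of _ ?N ?N] state_def)
  have ov: "Re ((star s *\<^sub>v \<phi>) \<bullet>c \<phi>) \<le> 1" "Re ((face s *\<^sub>v \<phi>) \<bullet>c \<phi>) \<le> 1"
    "Re ((star s *\<^sub>v \<phi>) \<bullet>c \<phi>) = 1 \<Longrightarrow> star s *\<^sub>v \<phi> = \<phi>"
    "Re ((face s *\<^sub>v \<phi>) \<bullet>c \<phi>) = 1 \<Longrightarrow> face s *\<^sub>v \<phi> = \<phi>"
    if "s \<in> sites L" "state ?N \<phi>" for s \<phi>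
    using isometry_overlap[of _ ?N \<phi>] that
    by (auto simp: star_eq face_eq sqnorm_xstr sqnorm_zstr state_iff_sqnorm)
  have e: "Re (((star s + face s) *\<^sub>v \<phi>) \<bullet>c \<phi>) =
      Re ((star s *\<^sub>v \<phi>) \<bullet>c \<phi>) + Re ((face s *\<^sub>v \<phi>) \<bullet>c \<phi>)"
    if "s \<in> sites L" "state ?N \<phi>" for s \<phi>
    unfolding split[OF that] using that
    by (simp add: cscalar_prod_add_left[of _ ?N] star_eq face_eq state_def)
  have H: "toricH = - mat_sum ?N (\<lambda>s. star s + face s) (sites L)"
    unfolding toric_hamiltonian_def by (subst mat_sum_add) (auto simp: c)
  show ?thesis
    unfolding H
  \<comment> \<open>A local term pairs the star and the face with the same name. Each has
    expectation at most 1, so the total 2 requires both to be 1.\<close>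
  proof (rule frustration_free_ground_state[where c = 2])
    fix s \<phi> assume s: "s \<in> sites L" "state ?N \<phi>"
    show "Re (((star s + face s) *\<^sub>v \<phi>) \<bullet>c \<phi>) \<le> 2" using e[OF s] ov[OF s] by linarith
    show "Re (((star s + face s) *\<^sub>v \<phi>) \<bullet>c \<phi>) = 2 \<Longrightarrow> star s *\<^sub>v \<phi> = \<phi> \<and> face s *\<^sub>v \<phi> = \<phi>"
      using e[OF s] ov[OF s] by linarith
    show "star s *\<^sub>v \<phi> = \<phi> \<and> face s *\<^sub>v \<phi> = \<phi> \<Longrightarrow>
        (star s + face s) *\<^sub>v \<phi> = complex_of_real 2 \<cdot>\<^sub>v \<phi>"
      unfolding split[OF s] by (auto intro!: eq_vecI)
  qed (use c ex_toric_state in auto)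
qed

section \<open>Ground states of the transformed Hamiltonian\<close>

definition gauge_stabilized :: "complex vec \<Rightarrow> site \<Rightarrow> bool" where
  "gauge_stabilized \<psi> p \<longleftrightarrow>
    xstr (3 * L\<^sup>2) (at_idx L (star_X L (shift L (1, 1) p))) *\<^sub>v \<psi> = \<psi> \<and>
    zstr (3 * L\<^sup>2) (at_idx L (face_Z L (shift L (0, 1) p))) *\<^sub>v \<psi> = \<psi> \<and>
    xstr (3 * L\<^sup>2) (\<lambda>j. j = 2 * L\<^sup>2 + site_index L p) *\<^sub>v \<psi> +
    zstr (3 * L\<^sup>2) (\<lambda>j. j = 2 * L\<^sup>2 + site_index L p) *\<^sub>v \<psi> = complex_of_real (sqrt 2) \<cdot>\<^sub>v \<psi>"

text \<open>The product state satisfies the ancilla condition automatically, and the two stabilizer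
  strings act on the first factor alone, where the nonzero second factor can be cancelled.\<close>

lemma gauge_stabilized_tensor:
  assumes "\<psi> \<in> carrier_vec (2 ^ (2 * L\<^sup>2))" "\<chi> \<in> carrier_vec 2" "\<chi> $ 0 \<noteq> 0"
    "\<chi> $ 1 = (complex_of_real (sqrt 2) - 1) * \<chi> $ 0" "p \<in> sites L"
  shows "gauge_stabilized (tensor_state (2 * L\<^sup>2) (L\<^sup>2) \<psi> (product_state (L\<^sup>2) \<chi>)) p \<longleftrightarrow>
    star (shift L (1, 1) p) *\<^sub>v \<psi> = \<psi> \<and> face (shift L (0, 1) p) *\<^sub>v \<psi> = \<psi>"
proof -
  have p0: "product_state (L\<^sup>2) \<chi> $ 0 \<noteq> 0" using assms(3) by (simp add: product_state_0)
  let ?T = "tensor_state (2 * L\<^sup>2) (L\<^sup>2) \<psi> (product_state (L\<^sup>2) \<chi>)"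
  have "xstr (2 * L\<^sup>2 + L\<^sup>2) (at_idx L (star_X L v)) *\<^sub>v ?T = ?T \<longleftrightarrow>
      xstr (2 * L\<^sup>2) (at_idx L (star_X L v)) *\<^sub>v \<psi> = \<psi>"
    "zstr (2 * L\<^sup>2 + L\<^sup>2) (at_idx L (face_Z L v)) *\<^sub>v ?T = ?T \<longleftrightarrow>
      zstr (2 * L\<^sup>2) (at_idx L (face_Z L v)) *\<^sub>v \<psi> = \<psi>" for v
    by (rule xstr_tensor_fixed_iff[OF _ assms(1) p0], erule star_low)
      (rule zstr_tensor_fixed_iff[OF _ assms(1) p0], erule face_low)
  then show ?thesis
    unfolding gauge_stabilized_def qubit_count
      product_state_eigen[OF assms(4,1) site_index_less[OF assms(5)]]
      star_eq[OF shift_in_sites[OF pos]] face_eq[OF shift_in_sites[OF pos]]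
    by blast
qed

lemma conj_U_hamiltonian_gauge:
  "conj_by U (hamiltonian L) = - mat_sum (2 ^ (3 * L\<^sup>2))
    (\<lambda>p. gauge_term (3 * L\<^sup>2) (\<lambda>j. j = 2 * L\<^sup>2 + site_index L p)
      (at_idx L (star_X L (shift L (1, 1) p))) (at_idx L (face_Z L (shift L (0, 1) p)))) (sites L)"
  unfolding conj_U_hamiltonian
proof (rule arg_cong[where f = uminus], rule mat_sum_cong)
  fix p assume p: "p \<in> sites L"
  have J: "J_X L p = xstr (3 * L\<^sup>2) (\<lambda>j. j = 2 * L\<^sup>2 + site_index L p)"
    "J_Z L p = zstr (3 * L\<^sup>2) (\<lambda>j. j = 2 * L\<^sup>2 + site_index L p)"
    using p by (simp_all add: J_eq xq_def zq_def at_idx_single)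
  show "J_X L p + J_X L p * conj_by U (S_X L p) + J_Z L p + J_Z L p * conj_by U (S_Z L p) =
      gauge_term (3 * L\<^sup>2) (\<lambda>j. j = 2 * L\<^sup>2 + site_index L p)
      (at_idx L (star_X L (shift L (1, 1) p))) (at_idx L (face_Z L (shift L (0, 1) p)))"
    unfolding J conj_U_stabilizers[OF p] xq_def zq_def xstr_mult zstr_mult gauge_term_def ..
qed

lemma ex_gauge_state: "\<exists>\<phi>. state (2 ^ (3 * L\<^sup>2)) \<phi> \<and> (\<forall>p\<in>sites L. gauge_stabilized \<phi> p)"
proof -
  obtain \<phi> where \<phi>: "state (2 ^ (2 * L\<^sup>2)) \<phi>" "\<And>s. s \<in> sites L \<Longrightarrow> star s *\<^sub>v \<phi> = \<phi> \<and> face s *\<^sub>v \<phi> = \<phi>"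
    using ex_toric_state by blast
  obtain \<chi> where \<chi>: "state 2 \<chi>" "\<chi> $ 1 = (complex_of_real (sqrt 2) - 1) * \<chi> $ 0"
    using ex_sigma_eigenstate by blast
  let ?\<Phi> = "tensor_state (2 * L\<^sup>2) (L\<^sup>2) \<phi> (product_state (L\<^sup>2) \<chi>)"
  have "state (2 ^ (3 * L\<^sup>2)) ?\<Phi>"
    unfolding qubit_count
    by (subst state_tensor_product) (use \<phi>(1) \<chi>(1) in \<open>auto simp: state_def\<close>)
  moreover have "gauge_stabilized ?\<Phi> p" if "p \<in> sites L" for p
    using that \<phi> \<chi> sigma_eigenstate_ne_0[OF \<chi>]
    by (subst gauge_stabilized_tensor) (auto simp: state_def)
  ultimately show ?thesis by blast
qed

lemma gauge_ground_state_iff: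
  "ground_state (conj_by U (hamiltonian L)) \<psi> \<longleftrightarrow>
    state (2 ^ (3 * L\<^sup>2)) \<psi> \<and> (\<forall>p\<in>sites L. gauge_stabilized \<psi> p)"
  unfolding conj_U_hamiltonian_gauge
proof (rule frustration_free_ground_state[where c = "2 * sqrt 2"])
  let ?n = "3 * L\<^sup>2"
  fix p \<phi> assume p: "p \<in> sites L" and \<phi>: "state (2 ^ ?n) \<phi>"
  define s where "s = (\<lambda>j. j = 2 * L\<^sup>2 + site_index L p)"
  define a where "a = at_idx L (star_X L (shift L (1, 1) p))"
  define b where "b = at_idx L (face_Z L (shift L (0, 1) p))"
  have lt: "2 * L\<^sup>2 + site_index L p < ?n" using site_index_less[OF p] by simp
  \<comment> \<open>Stars and faces avoid the horizontal edges, so neither meets the qubit that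
    carries J and J'. This settles two of the three commuting pairs.\<close>
  have "\<not> a (2 * L\<^sup>2 + site_index L p)" "\<not> b (2 * L\<^sup>2 + site_index L p)"
    using star_low face_low unfolding a_def b_def by fastforce+
  then have "zsign ?n s (bits_of ?n b) = 1"
    using lt by (simp add: s_def zsign_single)
  then have zb: "zsign ?n b (bits_of ?n s) = 1"
    by (subst zsign_bits_of_commute)
  have z: "zsign ?n s (bits_of ?n s) = - 1" "zsign ?n s (bits_of ?n a) = 1"
    "zsign ?n b (bits_of ?n s) = 1" "zsign ?n b (bits_of ?n a) = 1"
    using lt p zb \<open>\<not> a (2 * L\<^sup>2 + site_index L p)\<close>
      star_face_commute[of "shift L (1, 1) p" "shift L (0, 1) p" ?n]
    by (simp_all add: s_def zsign_single a_def b_def)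
  have \<phi>c: "\<phi> \<in> carrier_vec (2 ^ ?n)" using \<phi> by (simp add: state_def)
  have gs: "gauge_stabilized \<phi> p \<longleftrightarrow> xstr ?n a *\<^sub>v \<phi> = \<phi> \<and> zstr ?n b *\<^sub>v \<phi> = \<phi> \<and>
      xstr ?n s *\<^sub>v \<phi> + zstr ?n s *\<^sub>v \<phi> = complex_of_real (sqrt 2) \<cdot>\<^sub>v \<phi>"
    by (simp add: gauge_stabilized_def s_def a_def b_def)
  show "Re ((gauge_term ?n s a b *\<^sub>v \<phi>) \<bullet>c \<phi>) \<le> 2 * sqrt 2"
    by (rule gauge_term_expectation(1)[OF z \<phi>])
  {
    assume "Re ((gauge_term ?n s a b *\<^sub>v \<phi>) \<bullet>c \<phi>) = 2 * sqrt 2"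
    note t = gauge_term_expectation(2)[OF z \<phi> this]
    then have "2 \<cdot>\<^sub>v (xstr ?n s *\<^sub>v \<phi> + zstr ?n s *\<^sub>v \<phi>) = (2 * complex_of_real (sqrt 2)) \<cdot>\<^sub>v \<phi>"
      using gauge_term_stabilized[OF \<phi>c, of a b s] by simp
    then have "xstr ?n s *\<^sub>v \<phi> + zstr ?n s *\<^sub>v \<phi> = complex_of_real (sqrt 2) \<cdot>\<^sub>v \<phi>"
      by (rule smult_vec_cancel[rotated]) simp
    then show "gauge_stabilized \<phi> p" unfolding gs using t by blast
  next
    assume "gauge_stabilized \<phi> p"
    then show "gauge_term ?n s a b *\<^sub>v \<phi> = complex_of_real (2 * sqrt 2) \<cdot>\<^sub>v \<phi>"
      unfolding gs using gauge_term_stabilized[OF \<phi>c, of a b s] by (simp add: smult_smult_assoc)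
  }
qed (use ex_gauge_state in auto)

text \<open>Shifts permute the sites, so the stars and faces labelled by plaquettes exhaust all
  stars and faces.\<close>

lemma toric_ground_state_shifted_iff:
  "ground_state toricH \<psi> \<longleftrightarrow> state (2 ^ (2 * L\<^sup>2)) \<psi> \<and>
    (\<forall>p\<in>sites L. star (shift L (1, 1) p) *\<^sub>v \<psi> = \<psi> \<and> face (shift L (0, 1) p) *\<^sub>v \<psi> = \<psi>)"
proof -
  have "(\<forall>p\<in>sites L. Q (shift L d p)) \<longleftrightarrow> (\<forall>s\<in>sites L. Q s)" for Q d
    using shift_image[OF pos, of d] by (metis imageE imageI)
  from this[of "\<lambda>s. star s *\<^sub>v \<psi> = \<psi>" "(1, 1)"] this[of "\<lambda>s. face s *\<^sub>v \<psi> = \<psi>" "(0, 1)"]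
  show ?thesis unfolding toric_ground_state_iff ball_conj_distrib by simp
qed

lemma gauge_ground_state_tensor_iff:
  "ground_state (conj_by U (hamiltonian L)) \<psi> \<longleftrightarrow>
    (\<exists>\<psi>_top \<chi>. ground_state toricH \<psi>_top \<and> state 2 \<chi> \<and>
      (sigma_x + sigma_z) *\<^sub>v \<chi> = complex_of_real (sqrt 2) \<cdot>\<^sub>v \<chi> \<and>
      \<psi> = tensor_state (2 * L\<^sup>2) (L\<^sup>2) \<psi>_top (product_state (L\<^sup>2) \<chi>))"
proof
  assume "ground_state (conj_by U (hamiltonian L)) \<psi>"
  then have \<psi>: "state (2 ^ (3 * L\<^sup>2)) \<psi>" and g: "\<And>p. p \<in> sites L \<Longrightarrow> gauge_stabilized \<psi> p"
    by (auto simp: gauge_ground_state_iff)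
  \<comment> \<open>One normalised eigenvector is fixed here. Any other differs from it by a phase,
    so the product state changes by a phase as well, and the first tensor factor absorbs it.\<close>
  obtain \<chi> where \<chi>: "state 2 \<chi>" "\<chi> $ 1 = (complex_of_real (sqrt 2) - 1) * \<chi> $ 0"
    using ex_sigma_eigenstate by blast
  note \<chi>0 = sigma_eigenstate_ne_0[OF \<chi>]
  have \<chi>c: "\<chi> \<in> carrier_vec 2" using \<chi> by (simp add: state_def)
  define \<phi> where "\<phi> = vec (2 ^ (2 * L\<^sup>2)) (\<lambda>i. \<psi> $ i / (\<chi> $ 0) ^ L\<^sup>2)"
  have \<phi>c: "\<phi> \<in> carrier_vec (2 ^ (2 * L\<^sup>2))" by (simp add: \<phi>_def)
  have \<psi>_eq: "\<psi> = tensor_state (2 * L\<^sup>2) (L\<^sup>2) \<phi> (product_state (L\<^sup>2) \<chi>)"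
    unfolding \<phi>_def
  proof (rule eigen_imp_tensor_product[OF \<chi>(2) \<chi>0])
    show "\<psi> \<in> carrier_vec (2 ^ (2 * L\<^sup>2 + L\<^sup>2))" using \<psi> by (simp add: state_def)
    fix q assume "q < L\<^sup>2"
    then obtain p where p: "p \<in> sites L" "q = site_index L p"
      using site_index_image[of L] by (metis imageE lessThan_iff)
    then show "xstr (2 * L\<^sup>2 + L\<^sup>2) (\<lambda>i. i = 2 * L\<^sup>2 + q) *\<^sub>v \<psi> +
        zstr (2 * L\<^sup>2 + L\<^sup>2) (\<lambda>i. i = 2 * L\<^sup>2 + q) *\<^sub>v \<psi> = complex_of_real (sqrt 2) \<cdot>\<^sub>v \<psi>"
      using g[OF p(1)] by (simp add: gauge_stabilized_def)
  qed
  \<comment> \<open>The product of unit vectors is a unit vector, so normalisation passes to the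
    first factor.\<close>
  have "state (2 ^ (2 * L\<^sup>2)) \<phi>"
    using \<psi> unfolding qubit_count \<psi>_eq state_tensor_product[OF \<phi>c \<chi>(1)] .
  then have "ground_state toricH \<phi>"
    unfolding toric_ground_state_shifted_iff
    using g gauge_stabilized_tensor[OF \<phi>c \<chi>c \<chi>0 \<chi>(2)] unfolding \<psi>_eq by blast
  then show "\<exists>\<psi>_top \<chi>. ground_state toricH \<psi>_top \<and> state 2 \<chi> \<and>
      (sigma_x + sigma_z) *\<^sub>v \<chi> = complex_of_real (sqrt 2) \<cdot>\<^sub>v \<chi> \<and>
      \<psi> = tensor_state (2 * L\<^sup>2) (L\<^sup>2) \<psi>_top (product_state (L\<^sup>2) \<chi>)"
    using \<chi> \<psi>_eq sigma_eigen_iff[OF \<chi>c] by blast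
next
  assume "\<exists>\<psi>_top \<chi>. ground_state toricH \<psi>_top \<and> state 2 \<chi> \<and>
      (sigma_x + sigma_z) *\<^sub>v \<chi> = complex_of_real (sqrt 2) \<cdot>\<^sub>v \<chi> \<and>
      \<psi> = tensor_state (2 * L\<^sup>2) (L\<^sup>2) \<psi>_top (product_state (L\<^sup>2) \<chi>)"
  then obtain \<phi> \<chi> where \<phi>: "ground_state toricH \<phi>" and \<chi>: "state 2 \<chi>"
    "(sigma_x + sigma_z) *\<^sub>v \<chi> = complex_of_real (sqrt 2) \<cdot>\<^sub>v \<chi>"
    and \<psi>: "\<psi> = tensor_state (2 * L\<^sup>2) (L\<^sup>2) \<phi> (product_state (L\<^sup>2) \<chi>)"
    by blast
  have \<chi>c: "\<chi> \<in> carrier_vec 2" using \<chi> by (simp add: state_def)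
  have \<chi>1: "\<chi> $ 1 = (complex_of_real (sqrt 2) - 1) * \<chi> $ 0" using \<chi>(2) sigma_eigen_iff[OF \<chi>c] by blast
  have \<phi>s: "state (2 ^ (2 * L\<^sup>2)) \<phi>" using \<phi> by (simp add: toric_ground_state_iff)
  then have \<phi>c: "\<phi> \<in> carrier_vec (2 ^ (2 * L\<^sup>2))" by (simp add: state_def)
  show "ground_state (conj_by U (hamiltonian L)) \<psi>"
    unfolding gauge_ground_state_iff
  proof (intro conjI ballI)
    show "state (2 ^ (3 * L\<^sup>2)) \<psi>"
      unfolding qubit_count \<psi> state_tensor_product[OF \<phi>c \<chi>(1)] by (rule \<phi>s)
    fix p assume "p \<in> sites L"
    then show "gauge_stabilized \<psi> p"
      using \<phi> gauge_stabilized_tensor[OF \<phi>c \<chi>c sigma_eigenstate_ne_0[OF \<chi>(1) \<chi>1] \<chi>1]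
      unfolding \<psi> toric_ground_state_shifted_iff by blast
  qed
qed

end

theorem mainTheorem3:
  shows "\<exists>c :: real. \<forall>L :: nat. L \<ge> 2 \<longrightarrow> (\<exists>gs1 gs2 gs3 gs4 U.
    cnot_round L c gs1 \<and> cnot_round L c gs2 \<and> cnot_round L c gs3 \<and> cnot_round L c gs4 \<and>
    U = cnot_product L gs4 * cnot_product L gs3 * cnot_product L gs2 * cnot_product L gs1 \<and>
    unitary_mat (2 ^ (3 * L\<^sup>2)) U \<and>
    (\<forall>p \<in> sites L. conj_by U (X_bar L p) = J_X L p \<and> conj_by U (Z_bar L p) = J_Z L p) \<and>
    conj_by U (hamiltonian L) =
      - mat_sum (2 ^ (3 * L\<^sup>2))
          (\<lambda>p. J_X L p + J_X L p * conj_by U (S_X L p) + J_Z L p + J_Z L p * conj_by U (S_Z L p))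
          (sites L) \<and>
    (\<exists>e1 e2 \<iota> \<sigma> \<tau>.
      lattice_basis e1 e2 \<and>
      bij_betw \<iota> (toric_edges L) (top_qubits L) \<and>
      bij_betw \<sigma> (sites L) (sites L) \<and> bij_betw \<tau> (sites L) (sites L) \<and>
      (\<forall>p \<in> sites L.
        conj_by U (S_X L p) = tensor_id (2 * L\<^sup>2) (L\<^sup>2) (star_op L e1 e2 \<iota> (\<sigma> p)) \<and>
        conj_by U (S_Z L p) = tensor_id (2 * L\<^sup>2) (L\<^sup>2) (face_op L e1 e2 \<iota> (\<tau> p))) \<and>
      (\<forall>\<psi>. ground_state (toric_hamiltonian L e1 e2 \<iota>) \<psi> \<longleftrightarrow>
        state (2 ^ (2 * L\<^sup>2)) \<psi> \<and>
        (\<forall>p \<in> sites L. star_op L e1 e2 \<iota> (\<sigma> p) *\<^sub>v \<psi> = \<psi> \<and> face_op L e1 e2 \<iota> (\<tau> p) *\<^sub>v \<psi> = \<psi>)) \<and>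
      (\<forall>\<psi>. ground_state (conj_by U (hamiltonian L)) \<psi> \<longleftrightarrow>
        (\<exists>\<psi>_top \<chi>.
          ground_state (toric_hamiltonian L e1 e2 \<iota>) \<psi>_top \<and>
          state 2 \<chi> \<and> (sigma_x + sigma_z) *\<^sub>v \<chi> = complex_of_real (sqrt 2) \<cdot>\<^sub>v \<chi> \<and>
          \<psi> = tensor_state (2 * L\<^sup>2) (L\<^sup>2) \<psi>_top (product_state (L\<^sup>2) \<chi>)))))"
proof (rule exI[of _ 1], intro allI impI, goal_cases)
  case (1 L)
  obtain ps where ps: "set ps = sites L" "distinct ps"
    using finite_distinct_list[OF finite_sites] by blast
  interpret torus L ps by unfold_locales (use 1 ps in auto)
  have basis: "lattice_basis (1, 0) (1, - 1)" by (simp add: lattice_basis_def)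
  show ?case
    apply (rule exI[of _ "gates HEdge Vertex ps"], rule exI[of _ "gates HEdge VEdge ps"],
        rule exI[of _ "gates Vertex west ps"], rule exI[of _ "gates VEdge west ps"],
        rule exI[of _ U])
    apply (intro conjI cnot_rounds U_def unitary_U ballI conj_U_bar conj_U_hamiltonian)
    apply assumption+
    \<comment> \<open>The star obtained from a plaquette sits at its north-east corner, and the face
      is named by its north-west corner; these are the two shifts.\<close>
    apply (rule exI[of _ "(1, 0)"], rule exI[of _ "(1, - 1)"], rule exI[of _ "edge_qubit L"],
        rule exI[of _ "shift L (1, 1)"], rule exI[of _ "shift L (0, 1)"])
    by (intro conjI ballI allI basis bij_edge_qubit bij_betw_shift pos conj_U_tensor_id
        toric_ground_state_shifted_iff gauge_ground_state_tensor_iff)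
qed

end
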